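(* Let $n\in\mathbb{N}$. (a) For $j=4$ and $j=5$, $$\mu(n,j)=\begin{cases}\left\lceil \frac{4n}{7}\right\rceil, & \text{if } n\neq 7k-2 \text{ for every } k\in\mathbb{N},\\[4pt] \left\lceil \frac{4n}{7}\right\rceil+1=4k, & \text{if } n=7k-2 \text{ for some } k\in\mathbb{N}.\end{cases}$$ (b) If $n\ge 4$, then $\mu^*(n,4)=2\left\lceil \frac{2n}{7}\right\rceil$, and this is the least even integer not less than $\mu(n,4)$.
   Context: $\mathbb{F}_2$ is the field with two elements. For $u\in\mathbb{F}_2^n$, the Hamming norm $|u|$ is the number of entries of $u$ equal to $1$. For an $n\times n$ matrix $W$ over $\mathbb{F}_2$ and $c\in\mathbb{F}_2^n$, let $M(W,c)=\max\{|Wx+c| : x\in\mathbb{F}_2^n\}$. For $n,m\ge 1$, $A(n,m)$ is the set of $n\times n$ matrices over $\mathbb{F}_2$ with all diagonal entries equal to $1$ and with every column containing at most $m$ entries equal to $1$; for $n\ge m\ge 1$, $A^*(n,m)$ is the set of matrices in $A(n,m)$ in which every column contains exactly $m$ entries equal to $1$. Define $\mu(n,m)=\min\{M(W,0): W\in A(n,m)\}$ and, for $n\ge m$, $\mu^*(n,m)=\min\{M(W,0): W\in A^*(n,m)\}$. Here $\mathbb{N}=\{1,2,3,\dots\}$. *)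

theory Defs
  imports Complex_Main "HOL-Library.Z2" "Jordan_Normal_Form.Matrix"
begin

text \<open>
  The field with two elements is \<^typ>\<open>bit\<close>. Vectors and matrices are those of
  Jordan normal form, so the dimension \<open>n\<close> is a natural number; indices run
  over \<open>0, \<dots>, n - 1\<close>.
\<close>

definition hamming_norm :: "bit vec \<Rightarrow> nat" where
  "hamming_norm u = card {i. i < dim_vec u \<and> u $ i = 1}"

text \<open>
  Meant for square \<open>W\<close> and \<open>c\<close> of the same dimension. The maximum is over a finite
  nonempty set.
\<close>
definition M :: "bit mat \<Rightarrow> bit vec \<Rightarrow> nat" where
  "M W c = Max {hamming_norm (W *\<^sub>v x + c) | x. x \<in> carrier_vec (dim_col W)}"

definition A :: "nat \<Rightarrow> nat \<Rightarrow> bit mat set" where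
  "A n m = {W \<in> carrier_mat n n.
     (\<forall>i<n. W $$ (i, i) = 1) \<and> (\<forall>j<n. hamming_norm (col W j) \<le> m)}"

definition A_star :: "nat \<Rightarrow> nat \<Rightarrow> bit mat set" where
  "A_star n m = {W \<in> A n m. \<forall>j<n. hamming_norm (col W j) = m}"

text \<open>
  The sets of values below are finite, being bounded by \<open>n\<close>. The first is nonempty for
  \<open>m \<ge> 1\<close>, the second for \<open>n \<ge> m \<ge> 1\<close>; outside these ranges the constants carry no
  meaning.
\<close>
definition mu :: "nat \<Rightarrow> nat \<Rightarrow> nat" where
  "mu n m = Min {M W (0\<^sub>v n) | W. W \<in> A n m}"

definition mu_star :: "nat \<Rightarrow> nat \<Rightarrow> nat" where
  "mu_star n m = Min {M W (0\<^sub>v n) | W. W \<in> A_star n m}"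

end

theory Submission
  imports Defs
begin

text \<open>
  The supports of the vectors \<open>W x\<close> form a binary code; conversely a code whose words of weight at
  most \<open>m\<close> cover all coordinates gives a matrix, column \<open>j\<close> being such a word through \<open>j\<close>. So \<open>\<mu>(n, m)\<close>
  is the least maximal weight of a code of length \<open>n\<close> covered by words of weight at most \<open>m\<close>.

  For the lower bound, let \<open>T\<close> be the union of some of the covering words, and \<open>t = card T\<close>. Puncturing at
  \<open>T\<close> and averaging over the words inside \<open>T\<close> adds at least \<open>t / 2\<close> to the bound for length \<open>n - t\<close>, which
  after rounding up suffices for odd \<open>t \<le> 7\<close>, except for \<open>t = 5\<close> and \<open>n \<equiv> 5 (mod 7)\<close>. If no union of at
  most 7 points is odd, then in a minimal cover every word has at least as many private as shared
  points, and the sum of the cover has weight at least \<open>2 n / 3\<close>. If \<open>n \<equiv> 5 (mod 7)\<close>, parity gives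
  better averages over unions of 6, 8, 10, 14 or 15 points, and the remaining covers consist of
  five-element sets meeting pairwise in one point. The Fano plane code, of length 7 and
  constant weight 4, is extremal.
\<close>

section \<open>Binary codes and averaging\<close>

definition linear_code :: "'a set set \<Rightarrow> bool" where
  "linear_code C \<longleftrightarrow> {} \<in> C \<and> (\<forall>a\<in>C. \<forall>b\<in>C. sym_diff a b \<in> C)"

lemma linear_codeD:
  assumes "linear_code C"
  shows "{} \<in> C" "a \<in> C \<Longrightarrow> b \<in> C \<Longrightarrow> sym_diff a b \<in> C"
  using assms by (auto simp: linear_code_def)

section \<open>Sums of words modulo 2 and averages over translates\<close>

lemma card_sym_diff:
  assumes "finite a" "finite b"
  shows "card (sym_diff a b) + 2 * card (a \<inter> b) = card a + card b"
proof -
  have "card (sym_diff a b) = card (a - b) + card (b - a)"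
    using assms by (intro card_Un_disjoint) auto
  moreover have "card a = card (a - b) + card (a \<inter> b)"
    using assms card_Diff_subset_Int[of a b] card_mono[of a "a \<inter> b"] by simp
  moreover have "card b = card (b - a) + card (a \<inter> b)"
    using assms card_Diff_subset_Int[of b a] card_mono[of b "a \<inter> b"] by (simp add: Int_commute)
  ultimately show ?thesis by simp
qed

lemma even_card_sym_diff:
  assumes "finite a" "finite b"
  shows "even (card (sym_diff a b)) \<longleftrightarrow> (even (card a) \<longleftrightarrow> even (card b))"
  using card_sym_diff[OF assms] by (metis even_add even_mult_iff even_numeral)

lemma sym_diff_Int: "sym_diff a b \<inter> T = sym_diff (a \<inter> T) (b \<inter> T)"
  by auto

text \<open>This set is the sum modulo 2 of the words \<open>c j\<close>. The family is indexed so
  that a word may occur several times, as the columns of a matrix can.\<close>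

lemma odd_incidence_in_code:
  assumes "linear_code C" "finite J" "\<And>j. j \<in> J \<Longrightarrow> c j \<in> C"
  shows "{i. odd (card {j \<in> J. i \<in> c j})} \<in> C"
  using assms(2,3)
proof (induction J)
  case empty
  then show ?case using assms(1) by (simp add: linear_codeD)
next
  case (insert k J)
  have "card {j \<in> insert k J. i \<in> c j} =
      (if i \<in> c k then Suc (card {j \<in> J. i \<in> c j}) else card {j \<in> J. i \<in> c j})" for i
  proof (cases "i \<in> c k")
    case True
    then have "{j \<in> insert k J. i \<in> c j} = insert k {j \<in> J. i \<in> c j}" by auto
    with True insert.hyps show ?thesis by simp
  next
    case False
    then have "{j \<in> insert k J. i \<in> c j} = {j \<in> J. i \<in> c j}" by auto
    with False show ?thesis by simp
  qed
  then have "{i. odd (card {j \<in> insert k J. i \<in> c j})} =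
      sym_diff {i. odd (card {j \<in> J. i \<in> c j})} (c k)"
    by (auto split: if_splits)
  with insert linear_codeD(2)[OF assms(1)] show ?case by simp
qed

text \<open>For a point \<open>i\<close> of \<open>T\<close> pick a word \<open>e\<close> of
  \<open>D\<close> through \<open>i\<close>. Adding \<open>e\<close> is an involution of
  \<open>D\<close> that toggles membership of \<open>i\<close> in the translate, so \<open>i\<close>
  lies in exactly half of the translates; counting the incidences in both orders gives the
  sum.\<close>

lemma sum_card_translates:
  assumes "linear_code D" "finite D" "finite T" "T \<subseteq> \<Union>D"
  shows "2 * (\<Sum>d\<in>D. card (sym_diff c d \<inter> T)) = card T * card D"
proof -
  have half: "2 * card {d \<in> D. i \<in> sym_diff c d} = card D" if "i \<in> T" for i
  proof -
    from that assms(4) obtain e where e: "e \<in> D" "i \<in> e" by auto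
    have "bij_betw (\<lambda>d. sym_diff d e) {d \<in> D. i \<in> sym_diff c d} {d \<in> D. i \<notin> sym_diff c d}"
    proof (rule bij_betw_byWitness[where f' = "\<lambda>d. sym_diff d e"])
      show "\<forall>a\<in>{d \<in> D. i \<in> sym_diff c d}. sym_diff (sym_diff a e) e = a" by auto
      show "\<forall>a\<in>{d \<in> D. i \<notin> sym_diff c d}. sym_diff (sym_diff a e) e = a" by auto
      have "sym_diff d e \<in> D" if "d \<in> D" for d
        using linear_codeD(2)[OF assms(1)] that e by simp
      then show "(\<lambda>d. sym_diff d e) ` {d \<in> D. i \<in> sym_diff c d} \<subseteq> {d \<in> D. i \<notin> sym_diff c d}"
        and "(\<lambda>d. sym_diff d e) ` {d \<in> D. i \<notin> sym_diff c d} \<subseteq> {d \<in> D. i \<in> sym_diff c d}"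
        using e by auto
    qed
    then have "card {d \<in> D. i \<in> sym_diff c d} = card {d \<in> D. i \<notin> sym_diff c d}"
      by (rule bij_betw_same_card)
    moreover have "card D = card {d \<in> D. i \<in> sym_diff c d} + card {d \<in> D. i \<notin> sym_diff c d}"
      by (subst card_Un_disjoint[symmetric]) (use assms(2) in \<open>auto intro: arg_cong[where f = card]\<close>)
    ultimately show ?thesis by simp
  qed
  have "(\<Sum>d\<in>D. card (sym_diff c d \<inter> T)) = (\<Sum>d\<in>D. card {i \<in> T. i \<in> sym_diff c d})"
    by (intro sum.cong arg_cong[where f = card]) auto
  also have "\<dots> = (\<Sum>d\<in>D. \<Sum>i\<in>T. of_bool (i \<in> sym_diff c d))"
    using assms(3) by (simp only: card_eq_sum sum.If_cases of_bool_def sum.inter_filter)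
  also have "\<dots> = (\<Sum>i\<in>T. \<Sum>d\<in>D. of_bool (i \<in> sym_diff c d))"
    by (rule sum.swap)
  also have "\<dots> = (\<Sum>i\<in>T. card {d \<in> D. i \<in> sym_diff c d})"
    using assms(2) by (simp only: card_eq_sum sum.If_cases of_bool_def sum.inter_filter)
  finally have "2 * (\<Sum>d\<in>D. card (sym_diff c d \<inter> T)) = (\<Sum>i\<in>T. 2 * card {d \<in> D. i \<in> sym_diff c d})"
    by (simp add: sum_distrib_left)
  also have "\<dots> = (\<Sum>i\<in>T. card D)" by (intro sum.cong refl half)
  finally show ?thesis by simp
qed

text \<open>Some term reaches the average.\<close>

lemma translate_half:
  assumes "linear_code D" "finite D" "finite T" "T \<subseteq> \<Union>D"
  shows "\<exists>d\<in>D. card T \<le> 2 * card (sym_diff c d \<inter> T)"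
proof (rule ccontr)
  assume "\<not> ?thesis"
  then have "(\<Sum>d\<in>D. 2 * card (sym_diff c d \<inter> T)) < (\<Sum>d\<in>D. card T)"
    using assms(1,2) by (intro sum_strict_mono) (auto simp: linear_code_def not_le)
  with sum_card_translates[OF assms, of c] show False
    by (simp add: sum_distrib_left mult.commute)
qed

text \<open>Otherwise no term exceeds the average, so all terms equal it. But \<open>c\<close> and
  \<open>sym_diff c e\<close> meet \<open>T\<close> in numbers of different parity.\<close>

lemma translate_more_than_half:
  assumes "linear_code D" "finite D" "finite T" "T \<subseteq> \<Union>D"
    and "e \<in> D" "odd (card (e \<inter> T))"
  shows "\<exists>d\<in>D. card T < 2 * card (sym_diff c d \<inter> T)"
proof (rule ccontr)
  assume "\<not> ?thesis"
  then have le: "2 * card (sym_diff c d \<inter> T) \<le> card T" if "d \<in> D" for d using that by auto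
  have eq: "2 * card (sym_diff c d \<inter> T) = card T" if "d \<in> D" for d
  proof (rule ccontr)
    assume "2 * card (sym_diff c d \<inter> T) \<noteq> card T"
    with le that have "(\<Sum>d\<in>D. 2 * card (sym_diff c d \<inter> T)) < (\<Sum>d\<in>D. card T)"
      by (intro sum_strict_mono_ex1) (auto simp: assms(2) intro!: bexI[of _ d] le_neq_implies_less)
    with sum_card_translates[OF assms(1-4), of c] show False
      by (simp add: sum_distrib_left mult.commute)
  qed
  have "2 * card (c \<inter> T) = card T" using eq[of "{}"] assms(1) by (simp add: linear_codeD)
  moreover have "2 * card (sym_diff c e \<inter> T) = card T" using eq assms(5) by simp
  ultimately have "card (sym_diff (c \<inter> T) (e \<inter> T)) = card (c \<inter> T)" by (simp add: sym_diff_Int)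
  with even_card_sym_diff[of "c \<inter> T" "e \<inter> T"] assms(3,6) show False by simp
qed

text \<open>
  The even and the odd words of \<open>D\<close> have the same average, but the translates by one of the two classes
  never have weight \<open>(card T + 1) / 2\<close>.
\<close>
lemma translate_half_plus_three_halves:
  assumes "linear_code D" "finite D" "finite T" "T \<subseteq> \<Union>{d \<in> D. even (card (d \<inter> T))}"
    and "e \<in> D" "odd (card (e \<inter> T))" "odd (card T)"
  shows "\<exists>d\<in>D. card T + 3 \<le> 2 * card (sym_diff c d \<inter> T)"
proof -
  define D' where "D' = {d \<in> D. even (card (d \<inter> T))}"
  have D': "linear_code D'"
    using assms(1,3) by (auto simp: linear_code_def D'_def sym_diff_Int even_card_sym_diff)
  have step: "\<exists>d\<in>D. card T + 3 \<le> 2 * card (sym_diff c d \<inter> T)"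
    if b: "b \<in> D" "even (card (sym_diff c b \<inter> T)) \<longleftrightarrow> even ((card T + 3) div 2)" for b
  proof -
    obtain d where d: "d \<in> D'" "card T \<le> 2 * card (sym_diff (sym_diff c b) d \<inter> T)"
      using translate_half[OF D' _ assms(3), of "sym_diff c b"] assms(2,4)
      by (auto simp: D'_def)
    define x where "x = card (sym_diff (sym_diff c b) d \<inter> T)"
    have "even x \<longleftrightarrow> even ((card T + 3) div 2)"
      using d(1) b(2) assms(3) unfolding x_def D'_def
      by (subst sym_diff_Int) (simp add: even_card_sym_diff)
    moreover have "card T \<le> 2 * x" using d(2) by (simp add: x_def)
    ultimately have "card T + 3 \<le> 2 * x" using assms(7) by presburger
    moreover have "sym_diff (sym_diff c b) d = sym_diff c (sym_diff b d)" by auto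
    moreover have "sym_diff b d \<in> D"
      using linear_codeD(2)[OF assms(1)] b(1) d(1) by (simp add: D'_def)
    ultimately show ?thesis unfolding x_def by metis
  qed
  \<comment> \<open>The shifts by \<open>{}\<close> and by \<open>e\<close> lead to opposite
    parities on \<open>T\<close>, so one of them fits \<open>step\<close>.\<close>
  have "even (card (sym_diff c e \<inter> T)) \<noteq> even (card (sym_diff c {} \<inter> T))"
    using assms(3,6) by (simp add: sym_diff_Int even_card_sym_diff)
  with step[of e] step[of "{}"] assms(1,5) show ?thesis by (auto simp: linear_codeD)
qed

section \<open>Codes covered by light words: subcodes, puncturing, extension\<close>

definition code_on :: "nat \<Rightarrow> 'a set \<Rightarrow> 'a set set \<Rightarrow> bool" where
  "code_on w U C \<longleftrightarrow> finite U \<and> linear_code C \<and> C \<subseteq> Pow U \<and> (\<forall>i\<in>U. \<exists>c\<in>C. i \<in> c \<and> card c \<le> w)"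

lemma code_onD:
  assumes "code_on w U C"
  shows "finite U" "linear_code C" "finite C" "c \<in> C \<Longrightarrow> c \<subseteq> U" "c \<in> C \<Longrightarrow> finite c"
    "i \<in> U \<Longrightarrow> \<exists>c\<in>C. i \<in> c \<and> card c \<le> w"
proof -
  show U: "finite U" and "linear_code C" and sub: "c \<in> C \<Longrightarrow> c \<subseteq> U" for c
    using assms by (auto simp: code_on_def)
  show "c \<in> C \<Longrightarrow> finite c" using sub U by (rule finite_subset)
  show "finite C" using assms by (auto simp: code_on_def intro: finite_subset)
  show "i \<in> U \<Longrightarrow> \<exists>c\<in>C. i \<in> c \<and> card c \<le> w"
    using assms by (auto simp: code_on_def)
qed

lemma linear_code_subwords:
  "linear_code C \<Longrightarrow> linear_code {c \<in> C. c \<subseteq> T}"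
  by (auto simp: linear_code_def)

lemma code_on_subwords:
  assumes "code_on w U C" "G \<subseteq> C" "\<And>g. g \<in> G \<Longrightarrow> card g \<le> w"
  shows "code_on w (\<Union>G) {c \<in> C. c \<subseteq> \<Union>G}"
proof -
  have "\<Union>G \<subseteq> U" using assms(2) code_onD(4)[OF assms(1)] by auto
  with code_onD(1)[OF assms(1)] have "finite (\<Union>G)" by (rule rev_finite_subset)
  moreover have "\<exists>c\<in>{c \<in> C. c \<subseteq> \<Union>G}. i \<in> c \<and> card c \<le> w" if "i \<in> \<Union>G" for i
  proof -
    from that obtain g where "g \<in> G" "i \<in> g" by auto
    then show ?thesis using assms(2,3) by (intro bexI[of _ g]) auto
  qed
  ultimately show ?thesis
    using linear_code_subwords[OF code_onD(2)[OF assms(1)], of "\<Union>G"] by (auto simp: code_on_def)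
qed

lemma code_on_puncture:
  assumes "code_on w U C"
  shows "code_on w (U - T) ((\<lambda>c. c - T) ` C)"
  unfolding code_on_def
proof (intro conjI ballI)
  show "finite (U - T)" using code_onD[OF assms] by simp
  have "sym_diff (a - T) (b - T) = sym_diff a b - T" for a b :: "'a set" by auto
  then show "linear_code ((\<lambda>c. c - T) ` C)"
    using code_onD(2)[OF assms] by (auto simp: linear_code_def intro: rev_image_eqI)
  show "(\<lambda>c. c - T) ` C \<subseteq> Pow (U - T)" using code_onD(4)[OF assms] by auto
  fix i assume i: "i \<in> U - T"
  then obtain c where c: "c \<in> C" "i \<in> c" "card c \<le> w" using code_onD(6)[OF assms] by auto
  have "card (c - T) \<le> card c"
    by (rule card_mono) (use c code_onD(5)[OF assms] in auto)
  with c i show "\<exists>c\<in>(\<lambda>c. c - T) ` C. i \<in> c \<and> card c \<le> w"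
    by (intro bexI[of _ "c - T"]) auto
qed

lemma card_translate_subword:
  assumes "finite c" "finite d" "d \<subseteq> T"
  shows "card (sym_diff c d) = card (c - T) + card (sym_diff c d \<inter> T)"
proof -
  have "card (sym_diff c d) = card ((c - T) \<union> (sym_diff c d \<inter> T))"
    using assms(3) by (intro arg_cong[where f = card]) auto
  also have "\<dots> = card (c - T) + card (sym_diff c d \<inter> T)"
    using assms by (intro card_Un_disjoint) auto
  finally show ?thesis .
qed

text \<open>Adding words inside \<open>\<Union>G\<close> leaves \<open>c\<close> unchanged outside,
  so the part of \<open>c\<close> outside is kept while the inside is replaced by a good translate.
  The three claims correspond to the three translate lemmas.\<close>

lemma extend_word:
  assumes C: "code_on w U C" and G: "G \<subseteq> C" and c: "c \<in> C"
  shows "\<exists>c'\<in>C. 2 * card (c - \<Union>G) + card (\<Union>G) \<le> 2 * card c'"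
    and "\<lbrakk>e \<in> G; odd (card e)\<rbrakk> \<Longrightarrow> \<exists>c'\<in>C. 2 * card (c - \<Union>G) + card (\<Union>G) < 2 * card c'"
    and "\<lbrakk>e \<in> G; odd (card e); odd (card (\<Union>G)); \<And>i. i \<in> \<Union>G \<Longrightarrow> \<exists>d\<in>C. i \<in> d \<and> d \<subseteq> \<Union>G \<and> even (card d)\<rbrakk> \<Longrightarrow>
      \<exists>c'\<in>C. 2 * card (c - \<Union>G) + card (\<Union>G) + 3 \<le> 2 * card c'"
proof -
  define D where "D = {d \<in> C. d \<subseteq> \<Union>G}"
  note CD = code_onD[OF C]
  have D: "linear_code D" "finite D" "\<Union>G \<subseteq> \<Union>D"
    using linear_code_subwords[OF CD(2)] CD(3) G by (auto simp: D_def)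
  have T: "finite (\<Union>G)"
    by (rule finite_subset[OF _ CD(1)]) (use CD(4) G in auto)
  \<comment> \<open>\<open>P\<close> stands for the three forms of the bound; the weight splits into
    the part outside and the part inside \<open>\<Union>G\<close>.\<close>
  have lift: "\<exists>c'\<in>C. P (2 * card c')"
    if "\<exists>d\<in>D. P (2 * card (c - \<Union>G) + 2 * card (sym_diff c d \<inter> \<Union>G))" for P
  proof -
    from that obtain d where d: "d \<in> D" "P (2 * card (c - \<Union>G) + 2 * card (sym_diff c d \<inter> \<Union>G))" by auto
    have "sym_diff c d \<in> C" using linear_codeD(2)[OF CD(2) c] d(1) by (auto simp: D_def)
    moreover have "card (sym_diff c d) = card (c - \<Union>G) + card (sym_diff c d \<inter> \<Union>G)"
      using card_translate_subword d(1) c CD(5) by (auto simp: D_def)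
    ultimately show ?thesis using d(2) by (intro bexI[of _ "sym_diff c d"]) (simp_all only: add_mult_distrib2)
  qed
  have e: "e \<in> G \<Longrightarrow> e \<in> D \<and> e \<inter> \<Union>G = e" for e using G by (auto simp: D_def)
  show "\<exists>c'\<in>C. 2 * card (c - \<Union>G) + card (\<Union>G) \<le> 2 * card c'"
  proof -
    have "\<exists>d\<in>D. card (\<Union>G) \<le> 2 * card (sym_diff c d \<inter> \<Union>G)"
      by (rule translate_half[OF D(1,2) T D(3)])
    then show ?thesis
      by (intro lift[where P = "\<lambda>x. 2 * card (c - \<Union>G) + card (\<Union>G) \<le> x"]) simp
  qed
  show "\<exists>c'\<in>C. 2 * card (c - \<Union>G) + card (\<Union>G) < 2 * card c'" if "e \<in> G" "odd (card e)"
  proof -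
    have "\<exists>d\<in>D. card (\<Union>G) < 2 * card (sym_diff c d \<inter> \<Union>G)"
      by (rule translate_more_than_half[OF D(1,2) T D(3)]) (use e[OF that(1)] that(2) in auto)
    then show ?thesis
      by (intro lift[where P = "\<lambda>x. 2 * card (c - \<Union>G) + card (\<Union>G) < x"]) simp
  qed
  show "\<exists>c'\<in>C. 2 * card (c - \<Union>G) + card (\<Union>G) + 3 \<le> 2 * card c'"
    if odd: "e \<in> G" "odd (card e)" "odd (card (\<Union>G))"
      and even: "\<And>i. i \<in> \<Union>G \<Longrightarrow> \<exists>d\<in>C. i \<in> d \<and> d \<subseteq> \<Union>G \<and> even (card d)"
  proof -
    have "\<Union>G \<subseteq> \<Union>{d \<in> D. even (card (d \<inter> \<Union>G))}"
    proof
      fix i assume "i \<in> \<Union>G"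
      then obtain d where "d \<in> C" "i \<in> d" "d \<subseteq> \<Union>G" "even (card d)" using even by meson
      then show "i \<in> \<Union>{d \<in> D. even (card (d \<inter> \<Union>G))}"
        by (intro UnionI[of d]) (auto simp: D_def Int_absorb2)
    qed
    then have "\<exists>d\<in>D. card (\<Union>G) + 3 \<le> 2 * card (sym_diff c d \<inter> \<Union>G)"
      by (rule translate_half_plus_three_halves[OF D(1,2) T]) (use e[OF odd(1)] odd(2,3) in auto)
    then show ?thesis
      by (intro lift[where P = "\<lambda>x. 2 * card (c - \<Union>G) + card (\<Union>G) + 3 \<le> x"]) simp
  qed
qed

section \<open>Incidence counting and minimal covers\<close>

lemma sum_incidence:
  assumes "finite F" "finite Q"
  shows "(\<Sum>g\<in>F. card (g \<inter> Q)) = (\<Sum>i\<in>Q. card {g \<in> F. i \<in> g})"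
proof -
  have "(\<Sum>g\<in>F. card (g \<inter> Q)) = (\<Sum>g\<in>F. card {i \<in> Q. i \<in> g})"
    by (intro sum.cong arg_cong[where f = card]) auto
  also have "\<dots> = (\<Sum>g\<in>F. \<Sum>i\<in>Q. of_bool (i \<in> g))"
    using assms(2) by (simp only: card_eq_sum sum.If_cases of_bool_def sum.inter_filter)
  also have "\<dots> = (\<Sum>i\<in>Q. \<Sum>g\<in>F. of_bool (i \<in> g))"
    by (rule sum.swap)
  also have "\<dots> = (\<Sum>i\<in>Q. card {g \<in> F. i \<in> g})"
    using assms(1) by (simp only: card_eq_sum sum.If_cases of_bool_def sum.inter_filter)
  finally show ?thesis .
qed

text \<open>Minimality is expressed by a private point of every member, the form in which it is used
  later.\<close>

definition minimal_cover :: "'a set set \<Rightarrow> 'a set \<Rightarrow> bool" where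
  "minimal_cover F U \<longleftrightarrow> finite F \<and> \<Union>F = U \<and> (\<forall>g\<in>F. \<exists>p\<in>g. \<forall>h\<in>F. p \<in> h \<longrightarrow> h = g)"

lemma minimal_cover_exists:
  assumes "finite F" "\<Union>F = U"
  shows "\<exists>F'\<subseteq>F. minimal_cover F' U"
  using assms
proof (induction "card F" arbitrary: F rule: less_induct)
  case less
  show ?case
  proof (cases "minimal_cover F U")
    case False
    then obtain g where g: "g \<in> F" "\<And>p. p \<in> g \<Longrightarrow> \<exists>h\<in>F. p \<in> h \<and> h \<noteq> g"
      using less.prems by (auto simp: minimal_cover_def)
    then have "\<Union>(F - {g}) = U" using less.prems by blast
    moreover have "card (F - {g}) < card F" using less.prems(1) g(1) by (rule card_Diff1_less)
    ultimately obtain F' where "F' \<subseteq> F - {g}" "minimal_cover F' U"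
      using less.hyps[of "F - {g}"] less.prems(1) by blast
    then show ?thesis by blast
  qed blast
qed

lemma code_on_minimal_cover:
  assumes "code_on w U C"
  obtains F where "F \<subseteq> C" "\<And>g. g \<in> F \<Longrightarrow> card g \<le> w" "minimal_cover F U"
proof -
  have "\<Union>{c \<in> C. card c \<le> w} = U"
    using code_onD(4,6)[OF assms] by blast
  with minimal_cover_exists[of "{c \<in> C. card c \<le> w}" U] code_onD(3)[OF assms] that
  show ?thesis by auto
qed

section \<open>The bound for generators of weight at most five\<close>

text \<open>The quotient is the ceiling of \<open>4 * n / 7\<close>, and the extra 1 is for
  \<open>n = 7 * k - 2\<close>.\<close>

definition light_bound :: "nat \<Rightarrow> nat" where
  "light_bound n = (4 * n + 6) div 7 + (if n mod 7 = 5 then 1 else 0)"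

section \<open>Arithmetic of the bound modulo 7\<close>

lemma light_bound_residue:
  "light_bound (7 * q + r) = 4 * q + light_bound r"
proof -
  have "4 * (7 * q + r) + 6 = (4 * r + 6) + 7 * (4 * q)" by simp
  then have "(4 * (7 * q + r) + 6) div 7 = 4 * q + (4 * r + 6) div 7"
    by (metis div_mult_self2 zero_neq_numeral add.commute)
  moreover have "(7 * q + r) mod 7 = r mod 7" by simp
  ultimately show ?thesis by (simp add: light_bound_def)
qed

lemma light_bound_values:
  "light_bound 0 = 0" "light_bound 1 = 1" "light_bound 2 = 2" "light_bound 3 = 2"
  "light_bound 4 = 3" "light_bound 5 = 4" "light_bound 6 = 4" "light_bound 7 = 4"
  "light_bound 8 = 5" "light_bound 9 = 6" "light_bound 10 = 6" "light_bound 11 = 7"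
  "light_bound 12 = 8" "light_bound 13 = 8" "light_bound 14 = 8" "light_bound 15 = 9"
  "light_bound 16 = 10" "light_bound 17 = 10" "light_bound 18 = 11" "light_bound 19 = 12"
  "light_bound 20 = 12" "light_bound 21 = 12"
  by (simp_all add: light_bound_def)

lemma light_bound_cases:
  fixes n :: nat
  obtains q r where "n = 7 * q + r" "r \<in> {0, 1, 2, 3, 4, 5, 6}"
proof
  show "n = 7 * (n div 7) + n mod 7" by simp
  show "n mod 7 \<in> {0, 1, 2, 3, 4, 5, 6}" by auto
qed

text \<open>Both sides grow by 4 when an argument grows by 7, so only pairs of residues have to be
  compared.\<close>

lemma light_bound_subadditive: "light_bound (a + b) \<le> light_bound a + light_bound b"
proof -
  obtain q r where a: "a = 7 * q + r" "r \<in> {0, 1, 2, 3, 4, 5, 6}" by (rule light_bound_cases)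
  obtain q' r' where b: "b = 7 * q' + r'" "r' \<in> {0, 1, 2, 3, 4, 5, 6}" by (rule light_bound_cases)
  have "a + b = 7 * (q + q') + (r + r')" using a b by simp
  then have "light_bound (a + b) = 4 * (q + q') + light_bound (r + r')"
    by (simp only: light_bound_residue)
  moreover have "light_bound (r + r') \<le> light_bound r + light_bound r'"
    using a(2) b(2) by (auto simp: light_bound_values simp del: One_nat_def add_2_eq_Suc add_2_eq_Suc')
  ultimately show ?thesis using a(1) b(1) by (simp add: light_bound_residue)
qed

lemma light_bound_two_thirds:
  assumes "2 * n \<le> 3 * x"
  shows "light_bound n \<le> x"
proof -
  obtain q r where n: "n = 7 * q + r" "r \<in> {0, 1, 2, 3, 4, 5, 6}" by (rule light_bound_cases)
  have "light_bound n = 4 * q + light_bound r" unfolding n(1) by (rule light_bound_residue)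
  with n assms show ?thesis by (auto simp: light_bound_def)
qed

lemma light_bound_add:
  obtains q r where "r \<in> {0, 1, 2, 3, 4, 5, 6}" "light_bound m = 4 * q + light_bound r"
    "light_bound (m + t) = 4 * q + light_bound (r + t)" "(m + t) mod 7 = (r + t) mod 7"
proof -
  obtain q r where m: "m = 7 * q + r" "r \<in> {0, 1, 2, 3, 4, 5, 6}" by (rule light_bound_cases)
  have "light_bound (m + t) = 4 * q + light_bound (r + t)"
    unfolding m(1) add.assoc by (rule light_bound_residue)
  moreover have "(m + t) mod 7 = (r + t) mod 7"
    unfolding m(1) add.assoc by simp
  moreover have "light_bound m = 4 * q + light_bound r"
    unfolding m(1) by (rule light_bound_residue)
  ultimately show ?thesis using m(2) by (intro that)
qed

text \<open>As \<open>x\<close> is an integer, odd \<open>t\<close> contributes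
  \<open>(t + 1) / 2\<close>. The bound grows by no more than this over \<open>t\<close> points,
  except for \<open>t = 5\<close> starting from residue 0, where it grows by 4.\<close>

lemma light_bound_odd_step:
  assumes "2 * light_bound m + t \<le> 2 * x" "t \<in> {1, 3, 5, 7}" "t \<noteq> 5 \<or> (m + t) mod 7 \<noteq> 5"
  shows "light_bound (m + t) \<le> x"
proof -
  obtain q r where "r \<in> {0, 1, 2, 3, 4, 5, 6}" "light_bound m = 4 * q + light_bound r"
    "light_bound (m + t) = 4 * q + light_bound (r + t)" "(m + t) mod 7 = (r + t) mod 7"
    by (rule light_bound_add[of m t])
  with assms show ?thesis by (auto simp: light_bound_values simp del: One_nat_def add_2_eq_Suc add_2_eq_Suc')
qed

text \<open>For each of these \<open>t\<close>, reaching residue 5 requires a growth of exactly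
  \<open>t / 2 + 1\<close>, which is what the strict inequality provides.\<close>

lemma light_bound_even_step:
  assumes "2 * light_bound m + t < 2 * x" "t \<in> {6, 8, 10, 14}" "(m + t) mod 7 = 5"
  shows "light_bound (m + t) \<le> x"
proof -
  obtain q r where "r \<in> {0, 1, 2, 3, 4, 5, 6}" "light_bound m = 4 * q + light_bound r"
    "light_bound (m + t) = 4 * q + light_bound (r + t)" "(m + t) mod 7 = (r + t) mod 7"
    by (rule light_bound_add[of m t])
  with assms show ?thesis by (auto simp: light_bound_values simp del: One_nat_def add_2_eq_Suc add_2_eq_Suc')
qed

text \<open>Here \<open>m = 7 * q\<close>. The average gives only \<open>4 * q + 3\<close>, one less
  than required, and this value is odd.\<close>

lemma light_bound_step_5:
  assumes "2 * light_bound m + 5 \<le> 2 * x" "even x" "(m + 5) mod 7 = 5"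
  shows "light_bound (m + 5) \<le> x"
proof -
  obtain q r where qr: "r \<in> {0, 1, 2, 3, 4, 5, 6}" "light_bound m = 4 * q + light_bound r"
    "light_bound (m + 5) = 4 * q + light_bound (r + 5)" "(m + 5) mod 7 = (r + 5) mod 7"
    by (rule light_bound_add[of m 5])
  with assms(3) have "r = 0" by auto
  with qr assms show ?thesis by (simp add: light_bound_values) presburger
qed

text \<open>From residue 4 to \<open>4 + 15 = 19\<close> the bound grows from 3 to 12, that is by
  \<open>(15 + 3) / 2\<close>.\<close>

lemma light_bound_step_15:
  assumes "2 * light_bound m + 15 + 3 \<le> 2 * x" "(m + 15) mod 7 = 5"
  shows "light_bound (m + 15) \<le> x"
proof -
  obtain q r where "r \<in> {0, 1, 2, 3, 4, 5, 6}" "light_bound m = 4 * q + light_bound r"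
    "light_bound (m + 15) = 4 * q + light_bound (r + 15)" "(m + 15) mod 7 = (r + 15) mod 7"
    by (rule light_bound_add[of m 15])
  with assms show ?thesis by (auto simp: light_bound_values simp del: One_nat_def add_2_eq_Suc add_2_eq_Suc')
qed

lemma light_bound_less:
  assumes "n mod 7 = 5"
  shows "light_bound n \<le> n - 1"
proof -
  obtain q r where n: "n = 7 * q + r" "r \<in> {0, 1, 2, 3, 4, 5, 6}" by (rule light_bound_cases)
  have "light_bound n = 4 * q + light_bound r" unfolding n(1) by (rule light_bound_residue)
  with n assms show ?thesis by (auto simp: light_bound_def)
qed

text \<open>One step of the induction: puncture at \<open>\<Union>G\<close>, take a heavy word of
  the punctured code from the hypothesis and extend it back. \<open>f\<close> is the bound being
  proved, and \<open>m\<close> is the punctured length.\<close>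

lemma extend_word_hyp:
  fixes f :: "nat \<Rightarrow> nat" and U :: "'a set"
  assumes C: "code_on w U C" and G: "G \<subseteq> C" "\<Union>G \<noteq> {}"
    and IH: "\<And>(V :: 'a set) B. \<lbrakk>card V < card U; code_on w V B\<rbrakk> \<Longrightarrow> \<exists>b\<in>B. f (card V) \<le> card b"
  obtains m where "card U = m + card (\<Union>G)"
    and "\<exists>c\<in>C. 2 * f m + card (\<Union>G) \<le> 2 * card c"
    and "\<And>e. \<lbrakk>e \<in> G; odd (card e)\<rbrakk> \<Longrightarrow> \<exists>c\<in>C. 2 * f m + card (\<Union>G) < 2 * card c"
    and "\<And>e. \<lbrakk>e \<in> G; odd (card e); odd (card (\<Union>G));
        \<And>i. i \<in> \<Union>G \<Longrightarrow> \<exists>d\<in>C. i \<in> d \<and> d \<subseteq> \<Union>G \<and> even (card d)\<rbrakk> \<Longrightarrow>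
      \<exists>c\<in>C. 2 * f m + card (\<Union>G) + 3 \<le> 2 * card c"
proof -
  note CD = code_onD[OF C]
  have T: "\<Union>G \<subseteq> U" using CD(4) G(1) by auto
  define m where "m = card (U - \<Union>G)"
  have fin: "finite (\<Union>G)" using T CD(1) by (rule finite_subset)
  have le: "card (\<Union>G) \<le> card U" using T CD(1) by (intro card_mono)
  have m: "card U = m + card (\<Union>G)"
    using card_Diff_subset[OF fin T] le by (simp add: m_def)
  have "card (\<Union>G) > 0" using fin G(2) by (simp add: card_gt_0_iff)
  then have "card (U - \<Union>G) < card U" using m by (simp add: m_def)
  from IH[OF this code_on_puncture[OF C]] obtain c where c: "c \<in> C" "f m \<le> card (c - \<Union>G)"
    by (auto simp: m_def)
  note ext = extend_word[OF C G(1) c(1)]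
  show ?thesis
  proof (rule that[OF m])
    show "\<exists>c\<in>C. 2 * f m + card (\<Union>G) \<le> 2 * card c"
      using ext(1) c(2) by (meson add_le_mono1 le_trans mult_le_mono2)
    show "\<exists>c\<in>C. 2 * f m + card (\<Union>G) < 2 * card c" if "e \<in> G" "odd (card e)" for e
      using ext(2)[OF that] c(2) by (meson add_le_mono1 le_less_trans mult_le_mono2)
    show "\<exists>c\<in>C. 2 * f m + card (\<Union>G) + 3 \<le> 2 * card c"
      if "e \<in> G" "odd (card e)" "odd (card (\<Union>G))"
        "\<And>i. i \<in> \<Union>G \<Longrightarrow> \<exists>d\<in>C. i \<in> d \<and> d \<subseteq> \<Union>G \<and> even (card d)" for e
      using ext(3)[OF that] c(2) by (meson add_le_mono1 le_trans mult_le_mono2)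
  qed
qed

section \<open>Consequences of small unions in a minimal cover\<close>

lemma word_of_once_covered:
  assumes "code_on w U C" "F \<subseteq> C" "finite F"
  shows "\<exists>c\<in>C. card {i \<in> U. card {g \<in> F. i \<in> g} = 1} \<le> card c"
proof (intro bexI)
  let ?s = "{i. odd (card {g \<in> F. i \<in> g})}"
  show s: "?s \<in> C"
    using odd_incidence_in_code[OF code_onD(2)[OF assms(1)] assms(3), of "\<lambda>g. g"] assms(2) by auto
  show "card {i \<in> U. card {g \<in> F. i \<in> g} = 1} \<le> card ?s"
    by (rule card_mono) (use code_onD(5)[OF assms(1) s] in auto)
qed

lemma minimal_coverD:
  assumes "minimal_cover F U"
  shows "finite F" "\<Union>F = U" "g \<in> F \<Longrightarrow> \<exists>p\<in>g. \<forall>h\<in>F. p \<in> h \<longrightarrow> h = g"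
  using assms by (auto simp: minimal_cover_def)

text \<open>Let \<open>P\<close> be the points covered once and \<open>Q\<close> the others. If
  every member has at most as many points in \<open>Q\<close> as in \<open>P\<close>, counting
  incidences gives \<open>2 * card Q \<le> card P\<close>, and the sum of all members contains
  \<open>P\<close>.\<close>

lemma two_thirds_if_small_unions_even:
  assumes C: "code_on 5 U C" and F: "F \<subseteq> C" "minimal_cover F U" "\<And>g. g \<in> F \<Longrightarrow> card g \<le> 5"
    and even: "\<And>G. \<lbrakk>G \<subseteq> F; card (\<Union>G) \<le> 7\<rbrakk> \<Longrightarrow> even (card (\<Union>G))"
  shows "\<exists>c\<in>C. 2 * card U \<le> 3 * card c"
proof -
  note CD = code_onD[OF C] and FD = minimal_coverD[OF F(2)]
  define P where "P = {i \<in> U. card {g \<in> F. i \<in> g} = 1}"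
  define Q where "Q = U - P"
  have finPQ: "finite P" "finite Q" using CD(1) by (auto simp: P_def Q_def)
  have fin: "finite g" if "g \<in> F" for g using CD(5) F(1) that by auto
  have P_unique: "h = g" if "g \<in> F" "h \<in> F" "p \<in> P" "p \<in> g" "p \<in> h" for g h p
  proof -
    have "card {g \<in> F. p \<in> g} = 1" using that(3) by (simp add: P_def)
    then obtain x where x: "{g \<in> F. p \<in> g} = {x}" by (auto simp: card_1_singleton_iff)
    have "g \<in> {g \<in> F. p \<in> g}" "h \<in> {g \<in> F. p \<in> g}" using that by simp_all
    then show ?thesis unfolding x by simp
  qed
  have le: "card (g \<inter> Q) \<le> card (g \<inter> P)" if g: "g \<in> F" for g
  proof (rule ccontr)
    assume less: "\<not> ?thesis"
    obtain p where p: "p \<in> g" "\<forall>h\<in>F. p \<in> h \<longrightarrow> h = g" using FD(3)[OF g] by blast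
    then have "{h \<in> F. p \<in> h} = {g}" using g by blast
    then have "p \<in> g \<inter> P" using p(1) g FD(2) by (auto simp: P_def)
    then have "card (g \<inter> P) > 0" using finPQ by (auto simp: card_gt_0_iff)
    moreover have "card g = card (g \<inter> P) + card (g \<inter> Q)"
    proof -
      have "card g = card ((g \<inter> P) \<union> (g \<inter> Q))"
        using g FD(2) by (intro arg_cong[where f = card]) (auto simp: Q_def)
      also have "\<dots> = card (g \<inter> P) + card (g \<inter> Q)"
        using finPQ by (intro card_Un_disjoint) (auto simp: Q_def)
      finally show ?thesis .
    qed
    moreover have "even (card g)" "card g \<le> 5" using even[of "{g}"] F(3)[OF g] g by auto
    \<comment> \<open>Even size at most 4 and a private point leave one way to violate the claim:
      one point in \<open>P\<close> and three in \<open>Q\<close>.\<close>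
    ultimately have gP: "card (g \<inter> P) = 1" "card (g \<inter> Q) = 3" "card g = 4"
      using less by presburger+
    \<comment> \<open>Each such \<open>h\<close> meets \<open>g\<close> in a pair, and two different pairs give an odd union of at most 7 points.\<close>
    have other: "card h \<le> 4 \<and> even (card h) \<and> card (g \<inter> h) = 2 \<and> g \<inter> h \<subseteq> g \<inter> Q"
      if h: "h \<in> F" "h \<noteq> g" "z \<in> h" "z \<in> g" for h z
    proof -
      have "even (card h)" using even[of "{h}"] F(3)[OF h(1)] h(1) by auto
      then have h4: "even (card h)" "card h \<le> 4" using F(3)[OF h(1)] by presburger+
      have "z \<in> g \<inter> h" using h by auto
      then have pos: "card (g \<inter> h) > 0" using fin[OF g] by (auto simp: card_gt_0_iff)
      have un: "card g + card h = card (g \<union> h) + card (g \<inter> h)"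
        by (rule card_Un_Int) (use fin g h in auto)
      with pos h4 gP have "even (card (g \<union> h))" using even[of "{g, h}"] g h by auto
      then have "even (card (g \<inter> h))" using un h4 gP by presburger
      moreover have sub: "g \<inter> h \<subseteq> g \<inter> Q"
        using P_unique[OF g h(1)] h(2) g FD(2) by (auto simp: Q_def)
      then have "card (g \<inter> h) \<le> 3" using card_mono[OF _ sub] finPQ gP by simp
      ultimately have "card (g \<inter> h) = 2" using pos by presburger
      with h4 sub show ?thesis by simp
    qed
    have through: "\<exists>h\<in>F. h \<noteq> g \<and> z \<in> h" if z: "z \<in> g \<inter> Q" for z
    proof (rule ccontr)
      assume "\<not> ?thesis"
      then have "{h \<in> F. z \<in> h} = {g}" using z g by auto
      then have "z \<in> P" using z g FD(2) by (auto simp: P_def)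
      with z show False by (auto simp: Q_def)
    qed
    obtain a where "a \<in> g \<inter> Q" using gP(2) by (metis all_not_in_conv card.empty zero_neq_numeral)
    then obtain h where h: "h \<in> F" "h \<noteq> g" "a \<in> h" "a \<in> g" using through by blast
    note hh = other[OF h]
    have "\<not> g \<inter> Q \<subseteq> g \<inter> h"
      using card_mono[of "g \<inter> h" "g \<inter> Q"] fin[OF g] gP hh by auto
    then obtain b where b: "b \<in> g \<inter> Q" "b \<notin> h" by auto
    then obtain k where k: "k \<in> F" "k \<noteq> g" "b \<in> k" "b \<in> g" using through by blast
    note kk = other[OF k]
    have un1: "card (g \<inter> h) + card (g \<inter> k) = card ((g \<inter> h) \<union> (g \<inter> k)) + card ((g \<inter> h) \<inter> (g \<inter> k))"
      by (rule card_Un_Int) (use fin g in auto)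
    have "(g \<inter> h) \<union> (g \<inter> k) \<subseteq> g \<inter> Q" using hh kk by auto
    then have "card ((g \<inter> h) \<union> (g \<inter> k)) \<le> 3" using card_mono[of "g \<inter> Q"] finPQ gP by fastforce
    moreover have "card ((g \<inter> h) \<union> (g \<inter> k)) \<noteq> 2"
    proof
      assume "card ((g \<inter> h) \<union> (g \<inter> k)) = 2"
      then have "g \<inter> h = (g \<inter> h) \<union> (g \<inter> k)"
        using hh fin g by (intro card_subset_eq) auto
      with b k show False by auto
    qed
    moreover have "card (g \<inter> h) \<le> card ((g \<inter> h) \<union> (g \<inter> k))" using fin g by (intro card_mono) auto
    \<comment> \<open>Two different pairs inside the three shared points of \<open>g\<close> have
      exactly one point in common.\<close>
    ultimately have one: "card ((g \<inter> h) \<inter> (g \<inter> k)) = 1" using un1 hh kk by linarith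
    have hk: "card h + card k = card (h \<union> k) + card (h \<inter> k)"
      by (rule card_Un_Int) (use fin h k in auto)
    have "card ((g \<inter> h) \<inter> (g \<inter> k)) \<le> card (h \<inter> k)"
      using fin[OF h(1)] by (intro card_mono) auto
    then have "card (h \<inter> k) \<ge> 1" using one by simp
    \<comment> \<open>\<open>h \<union> k\<close> has at most \<open>4 + 4 - 1 = 7\<close> points,
      so its size is even by assumption.\<close>
    with hk hh kk have "even (card (h \<union> k))" using even[of "{h, k}"] h k by auto
    then have ehk: "even (card (h \<inter> k))" using hk hh kk by (metis even_add)
    have un2: "card (g \<inter> h) + card (h \<inter> k) = card ((g \<inter> h) \<union> (h \<inter> k)) + card ((g \<inter> h) \<inter> (h \<inter> k))"
      by (rule card_Un_Int) (use fin h in auto)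
    have un3: "card g + card k = card (g \<union> k) + card (g \<inter> k)"
      by (rule card_Un_Int) (use fin g k in auto)
    have un4: "card (g \<union> k) + card h = card ((g \<union> k) \<union> h) + card ((g \<union> k) \<inter> h)"
      by (rule card_Un_Int) (use fin g h k in auto)
    have "(g \<union> k) \<inter> h = (g \<inter> h) \<union> (h \<inter> k)" "(g \<inter> h) \<inter> (h \<inter> k) = (g \<inter> h) \<inter> (g \<inter> k)" by auto
    then have eqs: "card ((g \<union> k) \<inter> h) = card (g \<inter> h) + card (h \<inter> k) - 1" "card (h \<inter> k) \<ge> 1"
      using un2 one \<open>card (h \<inter> k) \<ge> 1\<close> by auto
    \<comment> \<open>Inclusion-exclusion for \<open>g\<close>, \<open>h\<close> and
      \<open>k\<close>. As \<open>h \<inter> k\<close> is even and nonempty, it has at least two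
      points, so the triple union is odd and has at most 7 points.\<close>
    have tot: "card ((g \<union> k) \<union> h) + card (h \<inter> k) = card h + card k + 1"
      using eqs un3 un4 gP hh kk by linarith
    have "even (card h + card k)" using hh kk by simp
    with tot ehk have "odd (card ((g \<union> k) \<union> h))" by presburger
    moreover have "2 \<le> card (h \<inter> k)" using eqs(2) ehk by presburger
    then have "card ((g \<union> k) \<union> h) \<le> 7" using tot hh kk by linarith
    moreover have "\<Union>{g, k, h} = (g \<union> k) \<union> h" by auto
    ultimately show False using even[of "{g, k, h}"] g h k by auto
  qed
  have "2 * card Q \<le> (\<Sum>i\<in>Q. card {g \<in> F. i \<in> g})"
  proof -
    have "2 \<le> card {g \<in> F. i \<in> g}" if i: "i \<in> Q" for i
    proof -
      from i FD(2) obtain g where "g \<in> F" "i \<in> g" by (auto simp: Q_def)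
      then have "card {g \<in> F. i \<in> g} \<noteq> 0" using FD(1) by auto
      moreover have "card {g \<in> F. i \<in> g} \<noteq> 1" using i by (auto simp: P_def Q_def)
      ultimately show ?thesis by linarith
    qed
    then have "(\<Sum>i\<in>Q. 2) \<le> (\<Sum>i\<in>Q. card {g \<in> F. i \<in> g})" by (rule sum_mono)
    then show ?thesis by simp
  qed
  also have "\<dots> = (\<Sum>g\<in>F. card (g \<inter> Q))" using sum_incidence[OF FD(1) finPQ(2)] by simp
  also have "\<dots> \<le> (\<Sum>g\<in>F. card (g \<inter> P))" by (intro sum_mono le)
  also have "\<dots> = (\<Sum>i\<in>P. card {g \<in> F. i \<in> g})" by (rule sum_incidence[OF FD(1) finPQ(1)])
  also have "\<dots> = card P" by (simp add: P_def)
  finally have "2 * card Q \<le> card P" .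
  moreover have "card U = card P + card Q"
    using card_Un_disjoint[of P Q] finPQ by (simp add: Q_def Un_absorb1 P_def)
  moreover obtain c where "c \<in> C" "card P \<le> card c"
    using word_of_once_covered[OF C F(1) FD(1)] by (auto simp: P_def)
  ultimately show ?thesis by (intro bexI[of _ c]) linarith+
qed

text \<open>An odd union of at most 7 points permits puncturing with rounding up; if there is none,
  the two-thirds bound applies. Only a union of 5 points at residue 5 escapes.\<close>

lemma light_bound_or_union_5:
  fixes U :: "'a set"
  assumes C: "code_on 5 U C" and F: "F \<subseteq> C" "minimal_cover F U" "\<And>g. g \<in> F \<Longrightarrow> card g \<le> 5"
    and IH: "\<And>(V :: 'a set) B. \<lbrakk>card V < card U; code_on 5 V B\<rbrakk> \<Longrightarrow> \<exists>b\<in>B. light_bound (card V) \<le> card b"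
  shows "(\<exists>c\<in>C. light_bound (card U) \<le> card c) \<or>
    (card U mod 7 = 5 \<and> (\<exists>G\<subseteq>F. card (\<Union>G) = 5) \<and> (\<forall>G\<subseteq>F. card (\<Union>G) \<notin> {1, 3, 7}))"
proof (cases "\<exists>G\<subseteq>F. card (\<Union>G) \<in> {1, 3, 5, 7} \<and> (card (\<Union>G) = 5 \<longrightarrow> card U mod 7 \<noteq> 5)")
  case True
  then obtain G where G: "G \<subseteq> F" "card (\<Union>G) \<in> {1, 3, 5, 7}" "card (\<Union>G) = 5 \<longrightarrow> card U mod 7 \<noteq> 5"
    by blast
  have GC: "G \<subseteq> C" using G(1) F(1) by (rule subset_trans)
  have "\<Union>G \<noteq> {}" using G(2) by (intro notI) simp
  from extend_word_hyp[OF C GC this, of light_bound, OF IH] obtain m c where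
    m: "card U = m + card (\<Union>G)" and c: "c \<in> C" "2 * light_bound m + card (\<Union>G) \<le> 2 * card c"
    by metis
  have "light_bound (card U) \<le> card c"
    unfolding m by (rule light_bound_odd_step[OF c(2) G(2)]) (use G(3) m in auto)
  with c(1) show ?thesis by blast
next
  case False
  then have no: "card (\<Union>G) \<notin> {1, 3, 7}" "card (\<Union>G) = 5 \<Longrightarrow> card U mod 7 = 5" if "G \<subseteq> F" for G
    using that by auto
  show ?thesis
  proof (cases "\<exists>G\<subseteq>F. card (\<Union>G) = 5")
    case True
    then show ?thesis using no by blast
  next
    case False
    have "even (card (\<Union>G))" if G: "G \<subseteq> F" "card (\<Union>G) \<le> 7" for G
    proof (rule ccontr)
      assume "odd (card (\<Union>G))"
      with G(2) have "card (\<Union>G) \<in> {1, 3, 5, 7}" by simp presburger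
      with no(1)[OF G(1)] False G(1) show False by auto
    qed
    from two_thirds_if_small_unions_even[OF C F(1,2) F(3) this] light_bound_two_thirds
    show ?thesis by blast
  qed
qed

text \<open>For generators of even weight the rounding loss at \<open>card U mod 7 = 5\<close> is recovered by parity.\<close>
lemma light_bound_even_generators:
  fixes U :: "'a set"
  assumes C: "code_on 5 U C" and F: "F \<subseteq> C" "minimal_cover F U" "\<And>g. g \<in> F \<Longrightarrow> card g \<le> 5"
    and IH: "\<And>(V :: 'a set) B. \<lbrakk>card V < card U; code_on 5 V B\<rbrakk> \<Longrightarrow> \<exists>b\<in>B. light_bound (card V) \<le> card b"
    and even: "\<And>g. g \<in> F \<Longrightarrow> even (card g)"
  shows "\<exists>c\<in>C. light_bound (card U) \<le> card c"
proof -
  note CD = code_onD[OF C] and FD = minimal_coverD[OF F(2)]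
  \<comment> \<open>The even subcode contains the cover, and the word found in it has the even
    weight that \<open>light_bound_step_5\<close> asks for.\<close>
  define E where "E = {c \<in> C. even (card c)}"
  have FE: "F \<subseteq> E" using F(1) even by (auto simp: E_def)
  have "sym_diff a b \<in> E" if "a \<in> E" "b \<in> E" for a b
    using that linear_codeD(2)[OF CD(2)] even_card_sym_diff[of a b] CD(5) by (auto simp: E_def)
  moreover have "{} \<in> E" using linear_codeD(1)[OF CD(2)] by (simp add: E_def)
  ultimately have lin: "linear_code E" by (simp add: linear_code_def)
  have E: "code_on 5 U E"
    unfolding code_on_def
  proof (intro conjI ballI)
    fix i assume "i \<in> U"
    then obtain g where "g \<in> F" "i \<in> g" using FD(2) by auto
    then show "\<exists>c\<in>E. i \<in> c \<and> card c \<le> 5" using F(3) FE by (intro bexI[of _ g]) auto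
  qed (use lin CD(1,4) in \<open>auto simp: E_def\<close>)
  from light_bound_or_union_5[OF E FE F(2,3) IH]
  consider c where "c \<in> E" "light_bound (card U) \<le> card c"
    | G where "card U mod 7 = 5" "G \<subseteq> F" "card (\<Union>G) = 5" by blast
  then show ?thesis
  proof cases
    case 1
    then show ?thesis by (auto simp: E_def)
  next
    case 2
    have GE: "G \<subseteq> E" using 2(2) FE by (rule subset_trans)
    have "\<Union>G \<noteq> {}" using 2(3) by (intro notI) simp
    from extend_word_hyp[OF E GE this, of light_bound, OF IH] obtain m c where
      m: "card U = m + card (\<Union>G)" and c: "c \<in> E" "2 * light_bound m + card (\<Union>G) \<le> 2 * card c"
      by metis
    have "light_bound (card U) \<le> card c"
      unfolding m 2(3) by (rule light_bound_step_5) (use c 2(1,3) m in \<open>auto simp: E_def\<close>)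
    with c(1) show ?thesis by (auto simp: E_def)
  qed
qed

text \<open>The hypothesis is applied to the words inside each part, not to punctured codes. Two
  heavy words from different parts are disjoint, so their weights add up, and subadditivity
  finishes.\<close>

lemma light_bound_disjoint_parts:
  fixes U :: "'a set"
  assumes C: "code_on 5 U C" and F: "F1 \<subseteq> C" "F2 \<subseteq> C" "\<Union>F1 \<union> \<Union>F2 = U" "\<Union>F1 \<inter> \<Union>F2 = {}"
    "\<Union>F1 \<noteq> {}" "\<Union>F2 \<noteq> {}" "\<And>g. g \<in> F1 \<union> F2 \<Longrightarrow> card g \<le> 5"
    and IH: "\<And>(V :: 'a set) B. \<lbrakk>card V < card U; code_on 5 V B\<rbrakk> \<Longrightarrow> \<exists>b\<in>B. light_bound (card V) \<le> card b"
  shows "\<exists>c\<in>C. light_bound (card U) \<le> card c"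
proof -
  note CD = code_onD[OF C]
  have fin: "finite (\<Union>F1)" "finite (\<Union>F2)" using CD(1) F(3) by auto
  have cU: "card U = card (\<Union>F1) + card (\<Union>F2)"
    using card_Un_disjoint[OF fin F(4)] F(3) by simp
  moreover have "card (\<Union>F1) > 0" "card (\<Union>F2) > 0" using fin F(5,6) card_gt_0_iff by blast+
  ultimately have less: "card (\<Union>F1) < card U" "card (\<Union>F2) < card U" by linarith+
  obtain c1 where c1: "c1 \<in> C" "c1 \<subseteq> \<Union>F1" "light_bound (card (\<Union>F1)) \<le> card c1"
    using IH[OF less(1) code_on_subwords[OF C F(1)]] F(7) by auto
  obtain c2 where c2: "c2 \<in> C" "c2 \<subseteq> \<Union>F2" "light_bound (card (\<Union>F2)) \<le> card c2"
    using IH[OF less(2) code_on_subwords[OF C F(2)]] F(7) by auto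
  have disj: "c1 \<inter> c2 = {}" using c1(2) c2(2) F(4) by blast
  have "card (sym_diff c1 c2) = card c1 + card c2"
    using card_sym_diff[of c1 c2] CD(5) c1(1) c2(1) disj by simp
  moreover have "light_bound (card U) \<le> light_bound (card (\<Union>F1)) + light_bound (card (\<Union>F2))"
    unfolding cU by (rule light_bound_subadditive)
  ultimately have "light_bound (card U) \<le> card (sym_diff c1 c2)" using c1(3) c2(3) by linarith
  with linear_codeD(2)[OF CD(2) c1(1) c2(1)] show ?thesis by blast
qed

text \<open>No point of \<open>h\<close> is in two members of \<open>G\<close>, so \<open>h\<close>
  meets the members in different points and shares \<open>card G\<close> points with their
  union.\<close>

lemma card_Un_meeting_once:
  assumes "\<And>g. g \<in> insert h G \<Longrightarrow> finite g" "finite G"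
    "\<And>g. g \<in> G \<Longrightarrow> card (h \<inter> g) = 1"
    "\<And>g g' i. \<lbrakk>g \<in> G; g' \<in> G; g \<noteq> g'; i \<in> g; i \<in> g'\<rbrakk> \<Longrightarrow> i \<notin> h"
  shows "card (\<Union>(insert h G)) + card G = card h + card (\<Union>G)"
proof -
  have "h \<inter> \<Union>G = (\<Union>g\<in>G. h \<inter> g)" by auto
  also have "card \<dots> = (\<Sum>g\<in>G. card (h \<inter> g))"
  proof (rule card_UN_disjoint[OF assms(2)])
    show "\<forall>g\<in>G. finite (h \<inter> g)" using assms(1) by simp
    show "\<forall>g\<in>G. \<forall>g'\<in>G. g \<noteq> g' \<longrightarrow> (h \<inter> g) \<inter> (h \<inter> g') = {}" using assms(4) by blast
  qed
  also have "\<dots> = (\<Sum>g\<in>G. 1)" using assms(3) by (intro sum.cong) auto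
  finally have "card (h \<inter> \<Union>G) = card G" by simp
  moreover have "card h + card (\<Union>G) = card (h \<union> \<Union>G) + card (h \<inter> \<Union>G)"
    using assms(1,2) by (intro card_Un_Int) auto
  ultimately show ?thesis by simp
qed

text \<open>Three members through one point and a fourth avoiding it have a union of
  \<open>5 + 4 + 4 + 2 = 15\<close> points. If no point is in three members, four of them have a
  union of \<open>5 + 4 + 3 + 2 = 14\<close> points. Both unions allow puncturing, which leaves a
  cover by three members, where the sum of the cover is heavy enough.\<close>

lemma light_bound_five_sets:
  fixes U :: "'a set"
  assumes C: "code_on 5 U C" and F: "F \<subseteq> C" "minimal_cover F U" "\<And>g. g \<in> F \<Longrightarrow> card g = 5"
    and meet: "\<And>g h. \<lbrakk>g \<in> F; h \<in> F; g \<noteq> h\<rbrakk> \<Longrightarrow> card (g \<inter> h) = 1"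
    and U: "card U mod 7 = 5"
    and IH: "\<And>(V :: 'a set) B. \<lbrakk>card V < card U; code_on 5 V B\<rbrakk> \<Longrightarrow> \<exists>b\<in>B. light_bound (card V) \<le> card b"
  shows "\<exists>c\<in>C. light_bound (card U) \<le> card c"
proof (rule ccontr)
  assume neg: "\<not> ?thesis"
  note CD = code_onD[OF C] and FD = minimal_coverD[OF F(2)]
  have fin: "finite g" if "g \<in> F" for g using CD(5) F(1) that by auto
  have single: "i = j" if "g \<in> F" "h \<in> F" "g \<noteq> h" "i \<in> g" "i \<in> h" "j \<in> g" "j \<in> h" for g h i j
  proof -
    have "card (g \<inter> h) = 1" by (rule meet[OF that(1-3)])
    then obtain x where x: "g \<inter> h = {x}" by (rule card_1_singletonE)
    have "i \<in> g \<inter> h" "j \<in> g \<inter> h" using that by simp_all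
    then show ?thesis unfolding x by simp
  qed
  \<comment> \<open>The sum of all members contains each point covered once, so a large
    \<open>W\<close> would contradict \<open>neg\<close>.\<close>
  have once: "card W < light_bound (card U)"
    if W: "W \<subseteq> U" "\<And>g h i. \<lbrakk>g \<in> F; h \<in> F; g \<noteq> h; i \<in> g; i \<in> h\<rbrakk> \<Longrightarrow> i \<notin> W" for W
  proof -
    have "card {g \<in> F. i \<in> g} = 1" if i: "i \<in> W" for i
    proof -
      obtain g where g: "g \<in> F" "i \<in> g" using i W(1) FD(2) by auto
      then have "{g \<in> F. i \<in> g} = {g}" using W(2) i by blast
      then show ?thesis by simp
    qed
    then have "W \<subseteq> {i \<in> U. card {g \<in> F. i \<in> g} = 1}" using W(1) by auto
    then have "card W \<le> card {i \<in> U. card {g \<in> F. i \<in> g} = 1}" using CD(1) by (intro card_mono) auto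
    moreover obtain c where "c \<in> C" "card {i \<in> U. card {g \<in> F. i \<in> g} = 1} \<le> card c"
      using word_of_once_covered[OF C F(1) FD(1)] by blast
    ultimately show ?thesis using neg by (meson not_le order.trans)
  qed
  \<comment> \<open>If all members shared \<open>p\<close>, any two would meet only there, and every
    other point would be covered once.\<close>
  have avoid: "\<exists>h\<in>F. p \<notin> h" for p
  proof (rule ccontr)
    assume all: "\<not> ?thesis"
    have "card (U - {p}) < light_bound (card U)"
    proof (rule once)
      fix g h i assume "g \<in> F" "h \<in> F" "g \<noteq> h" "i \<in> g" "i \<in> h"
      with single[of g h i p] all show "i \<notin> U - {p}" by auto
    qed auto
    moreover have "card U - 1 \<le> card (U - {p})" using CD(1) by (cases "p \<in> U") auto
    ultimately show False using light_bound_less[OF U] by linarith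
  qed
  have no14: "card (\<Union>G) \<noteq> 14" if G: "G \<subseteq> F" "e \<in> G" for G e
  proof
    assume 14: "card (\<Union>G) = 14"
    have GC: "G \<subseteq> C" using G(1) F(1) by (rule subset_trans)
    have ne: "\<Union>G \<noteq> {}" using 14 by (intro notI) simp
    have e: "odd (card e)" using F(3) G by auto
    obtain m c where m: "card U = m + card (\<Union>G)" and c: "c \<in> C" "2 * light_bound m + card (\<Union>G) < 2 * card c"
      by (rule extend_word_hyp[OF C GC ne, of light_bound, OF IH]) (use G(2) e in blast)+
    have "light_bound (card U) \<le> card c"
      unfolding m 14 by (rule light_bound_even_step) (use c m U 14 in auto)
    with c(1) neg show False by blast
  qed
  have union2: "card (\<Union>{g, h}) = 9" if "g \<in> F" "h \<in> F" "g \<noteq> h" for g h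
    using card_Un_Int[of g h] fin that meet[OF that] F(3) by simp
  have no_triple: False
    if g: "g1 \<in> F" "g2 \<in> F" "g3 \<in> F" "g1 \<noteq> g2" "g1 \<noteq> g3" "g2 \<noteq> g3" "p \<in> g1" "p \<in> g2" "p \<in> g3" for g1 g2 g3 p
  proof -
    obtain h where h: "h \<in> F" "p \<notin> h" using avoid by blast
    define G where "G = {g1, g2, g3}"
    have hG: "h \<notin> G" "h \<noteq> g1" "h \<noteq> g2" "h \<noteq> g3" using h(2) g by (auto simp: G_def)
    have in_two: "i = p" if "a \<in> G" "b \<in> G" "a \<noteq> b" "i \<in> a" "i \<in> b" for a b i
      using single[of a b i p] that g by (auto simp: G_def)
    have "card (\<Union>{g3, g1, g2}) = 13"
    proof -
      have "g3 \<inter> \<Union>{g1, g2} = {p}"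
        using g in_two by (auto simp: G_def)
      then have "card (g3 \<inter> \<Union>{g1, g2}) = 1" by simp
      moreover have "card g3 + card (\<Union>{g1, g2}) = card (g3 \<union> \<Union>{g1, g2}) + card (g3 \<inter> \<Union>{g1, g2})"
        by (rule card_Un_Int) (use fin g in auto)
      moreover have "\<Union>{g3, g1, g2} = g3 \<union> \<Union>{g1, g2}" by auto
      ultimately show ?thesis using union2[OF g(1,2,4)] F(3)[OF g(3)] by simp
    qed
    moreover have "{g3, g1, g2} = G" by (auto simp: G_def)
    ultimately have 13: "card (\<Union>G) = 13" by simp
    have "card (\<Union>(insert h G)) + card G = card h + card (\<Union>G)"
    proof (rule card_Un_meeting_once)
      show "finite x" if "x \<in> insert h G" for x using that fin g h by (auto simp: G_def)
      show "card (h \<inter> x) = 1" if "x \<in> G" for x using that meet h g hG by (auto simp: G_def)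
      show "i \<notin> h" if "a \<in> G" "b \<in> G" "a \<noteq> b" "i \<in> a" "i \<in> b" for a b i
        using in_two[OF that] h(2) by simp
    qed (simp add: G_def)
    moreover have "card G = 3" using g by (simp add: G_def)
    ultimately have 15: "card (\<Union>(insert h G)) = 15" using 13 F(3)[OF h(1)] by simp
    have GF: "insert h G \<subseteq> F" using h g by (auto simp: G_def)
    then have GC: "insert h G \<subseteq> C" using F(1) by (rule subset_trans)
    have ne: "\<Union>(insert h G) \<noteq> {}" using 15 by (metis card.empty zero_neq_numeral)
    have odd: "h \<in> insert h G" "odd (card h)" "odd (card (\<Union>(insert h G)))" using F(3)[OF h(1)] 15 by auto
    \<comment> \<open>The sum of a member through \<open>i\<close> and a member avoiding
      \<open>i\<close> is an even word through \<open>i\<close>, as both have 5 points.\<close>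
    have even: "\<exists>d\<in>C. i \<in> d \<and> d \<subseteq> \<Union>(insert h G) \<and> even (card d)" if i: "i \<in> \<Union>(insert h G)" for i
    proof -
      obtain a where a: "a \<in> insert h G" "i \<in> a" using i by auto
      \<comment> \<open>Only \<open>p\<close> lies in both \<open>g1\<close> and \<open>g2\<close>,
        and \<open>p\<close> is avoided by \<open>h\<close>.\<close>
      obtain b where b: "b \<in> insert h G" "i \<notin> b"
      proof (cases "i \<in> g1 \<and> i \<in> g2")
        case True
        then have "i = p" using in_two[of g1 g2 i] g by (simp add: G_def)
        with h(2) that[of h] show ?thesis by simp
      next
        case False
        with that[of g1] that[of g2] show ?thesis by (auto simp: G_def)
      qed
      have "even (card (sym_diff a b))"
        using even_card_sym_diff[of a b] fin F(3) a b GF by (metis in_mono)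
      moreover have "sym_diff a b \<in> C" using linear_codeD(2)[OF CD(2)] a b GC by blast
      moreover have "i \<in> sym_diff a b" "sym_diff a b \<subseteq> \<Union>(insert h G)" using a b by auto
      ultimately show ?thesis by (intro bexI[of _ "sym_diff a b"] conjI)
    qed
    obtain m c where m: "card U = m + card (\<Union>(insert h G))"
      and c: "c \<in> C" "2 * light_bound m + card (\<Union>(insert h G)) + 3 \<le> 2 * card c"
    proof (rule extend_word_hyp[OF C GC ne, of light_bound, OF IH])
      fix m assume m: "card U = m + card (\<Union>(insert h G))"
        and "\<And>e. \<lbrakk>e \<in> insert h G; odd (card e); odd (card (\<Union>(insert h G)));
          \<And>i. i \<in> \<Union>(insert h G) \<Longrightarrow> \<exists>d\<in>C. i \<in> d \<and> d \<subseteq> \<Union>(insert h G) \<and> even (card d)\<rbrakk> \<Longrightarrow>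
          \<exists>c\<in>C. 2 * light_bound m + card (\<Union>(insert h G)) + 3 \<le> 2 * card c"
      from this(2)[OF odd even] that[OF m] show ?thesis by blast
    qed
    have "light_bound (card U) \<le> card c"
      unfolding m 15 by (rule light_bound_step_15) (use c m U 15 in auto)
    with c(1) neg show False by blast
  qed
  have "F \<noteq> {}" using FD(2) U by auto
  then obtain g1 where g1: "g1 \<in> F" by blast
  obtain p where "p \<in> g1" using FD(3)[OF g1] by blast
  with avoid obtain g2 where g2: "g2 \<in> F" "g1 \<noteq> g2" by blast
  obtain q where q: "g1 \<inter> g2 = {q}" using meet[OF g1 g2] by (rule card_1_singletonE)
  \<comment> \<open>A member avoiding the common point \<open>q\<close> differs from
    \<open>g1\<close> and \<open>g2\<close>, both of which contain it.\<close>
  with avoid obtain g3 where g3: "g3 \<in> F" "g1 \<noteq> g3" "g2 \<noteq> g3" by (metis Int_iff insertI1)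
  have 12: "card (\<Union>{g3, g1, g2}) = 12"
  proof -
    have "card (\<Union>{g3, g1, g2}) + card {g1, g2} = card g3 + card (\<Union>{g1, g2})"
    proof (rule card_Un_meeting_once)
      show "i \<notin> g3" if "a \<in> {g1, g2}" "b \<in> {g1, g2}" "a \<noteq> b" "i \<in> a" "i \<in> b" for a b i
        using no_triple[OF g1 g2(1) g3(1) g2(2) g3(2,3), of i] that by auto
      show "card (g3 \<inter> x) = 1" if "x \<in> {g1, g2}" for x
        using that meet g1 g2 g3 by auto
    qed (use fin g1 g2 g3 in auto)
    then show ?thesis using union2[OF g1 g2] F(3)[OF g3(1)] g2(2) by simp
  qed
  show False
  proof (cases "F = {g3, g1, g2}")
    case True
    have U12: "card U = 12" using 12 FD(2) True by simp
    \<comment> \<open>Outside these at most three points every point is covered once. This leaves at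
      least 9 points, while \<open>light_bound 12 = 8\<close>.\<close>
    define S where "S = g1 \<inter> g2 \<union> g1 \<inter> g3 \<union> g2 \<inter> g3"
    have "card S \<le> card (g1 \<inter> g2) + card (g1 \<inter> g3) + card (g2 \<inter> g3)"
      unfolding S_def by (meson add_le_mono1 card_Un_le le_trans)
    then have S: "card S \<le> 3" using meet g1 g2 g3 by simp
    have "card (U - S) < light_bound (card U)"
    proof (rule once)
      show "i \<notin> U - S" if "g \<in> F" "h \<in> F" "g \<noteq> h" "i \<in> g" "i \<in> h" for g h i
        using that unfolding True S_def by auto
    qed auto
    moreover have "card U - card S \<le> card (U - S)"
      by (rule diff_card_le_card_Diff) (use fin g1 g2 in \<open>auto simp: S_def\<close>)
    ultimately show False using S U12 by (simp add: light_bound_def)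
  next
    case False
    then obtain g4 where g4: "g4 \<in> F" "g4 \<notin> {g3, g1, g2}" using g1 g2 g3 by blast
    have "card (\<Union>(insert g4 {g3, g1, g2})) + card {g3, g1, g2} = card g4 + card (\<Union>{g3, g1, g2})"
    proof (rule card_Un_meeting_once)
      show "i \<notin> g4" if "a \<in> {g3, g1, g2}" "b \<in> {g3, g1, g2}" "a \<noteq> b" "i \<in> a" "i \<in> b" for a b i
      proof
        assume "i \<in> g4"
        moreover have "a \<in> F" "b \<in> F" "a \<noteq> g4" "b \<noteq> g4" using that g1 g2 g3 g4 by auto
        ultimately show False using no_triple[of a b g4 i] that g4(1) by blast
      qed
      show "card (g4 \<inter> x) = 1" if "x \<in> {g3, g1, g2}" for x
        using that meet[of g4 x] g1 g2 g3 g4 by auto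
    qed (use fin g1 g2 g3 g4 in auto)
    moreover have "card {g3, g1, g2} = 3" using g2 g3 by auto
    ultimately have "card (\<Union>(insert g4 {g3, g1, g2})) = 14" using 12 F(3)[OF g4(1)] by simp
    with no14[of "insert g4 {g3, g1, g2}" g4] g1 g2 g3 g4 show False by blast
  qed
qed

text \<open>A counterexample with least \<open>card U\<close> has residue 5 and forbids unions of 1,
  3 or 7 points, and of 6, 8, 10 or 14 points if an odd generator takes part. This separates odd
  from even generators and fixes how the odd ones meet.\<close>

theorem light_bound_le_max_weight:
  assumes "code_on 5 U C"
  shows "\<exists>c\<in>C. light_bound (card U) \<le> card c"
  using assms
proof (induction "card U" arbitrary: U C rule: less_induct)
  case (less U C)
  note C = less.prems and CD = code_onD[OF less.prems]
  have IH: "\<exists>b\<in>B. light_bound (card V) \<le> card b" if "card V < card U" "code_on 5 V B" for V :: "'a set" and B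
    using less.hyps[OF that] .
  obtain F where F: "F \<subseteq> C" "\<And>g. g \<in> F \<Longrightarrow> card g \<le> 5" "minimal_cover F U"
    by (rule code_on_minimal_cover[OF C]) blast
  note FD = minimal_coverD[OF F(3)]
  have fin: "finite g" if "g \<in> F" for g using CD(5) F(1) that by auto
  show ?case
  proof (rule ccontr)
    assume neg: "\<not> ?thesis"
    with light_bound_or_union_5[OF C F(1,3) F(2) IH]
    have U: "card U mod 7 = 5" and odd_unions: "\<forall>G\<subseteq>F. card (\<Union>G) \<notin> {1, 3, 7}"
      by blast+
    have no_odd: "card (\<Union>G) \<notin> {1, 3, 7}" if "G \<subseteq> F" for G
      using odd_unions that by blast
    have no_even: "card (\<Union>G) \<notin> {6, 8, 10, 14}" if G: "G \<subseteq> F" "e \<in> G" "odd (card e)" for G e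
    proof
      assume t: "card (\<Union>G) \<in> {6, 8, 10, 14}"
      have GC: "G \<subseteq> C" using G(1) F(1) by (rule subset_trans)
      have ne: "\<Union>G \<noteq> {}" using t by (intro notI) simp
      obtain m c where m: "card U = m + card (\<Union>G)" and c: "c \<in> C" "2 * light_bound m + card (\<Union>G) < 2 * card c"
        by (rule extend_word_hyp[OF C GC ne, of light_bound, OF IH]) (use G(2,3) in blast)+
      have "light_bound (card U) \<le> card c"
        unfolding m by (rule light_bound_even_step[OF c(2) t]) (use m U in auto)
      with c(1) neg show False by blast
    qed
    have odd5: "card g = 5" if "g \<in> F" "odd (card g)" for g
    proof -
      have "card g \<notin> {1, 3}" using no_odd[of "{g}"] that(1) by simp
      moreover have "card g \<in> {1, 3, 5}" using that(2) F(2)[OF that(1)] by simp presburger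
      ultimately show ?thesis by simp
    qed
    have proper: "card (g \<inter> h) < card h" if gh: "g \<in> F" "h \<in> F" "g \<noteq> h" for g h
    proof -
      obtain p where "p \<in> h" "p \<notin> g" using FD(3)[OF gh(2)] gh by blast
      then have "g \<inter> h \<subset> h" by auto
      then show ?thesis using fin gh by (intro psubset_card_mono) auto
    qed
    have union: "card g + card h = card (\<Union>{g, h}) + card (g \<inter> h)" if "g \<in> F" "h \<in> F" for g h
      using card_Un_Int[of g h] fin that by simp
    \<comment> \<open>A nonempty proper intersection of a 5-set with a set of 2 or 4 points gives a
      union of 6, 7 or 8 points.\<close>
    have odd_even: "g \<inter> h = {}" if gh: "g \<in> F" "h \<in> F" "odd (card g)" "even (card h)" for g h
    proof -
      have ne: "g \<noteq> h" using gh(3,4) by auto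
      have no: "card (\<Union>{g, h}) \<notin> {6, 7, 8}"
        using no_odd[of "{g, h}"] no_even[of "{g, h}" g] gh by blast
      have "card h \<le> 4" using F(2)[OF gh(2)] gh(4) by presburger
      then have "card h \<in> {0, 2, 4}" using gh(4) by simp presburger
      with no proper[OF gh(1,2) ne] union[OF gh(1,2)] odd5[OF gh(1,3)]
      have "card (g \<inter> h) = 0" by auto
      then show ?thesis using fin gh by simp
    qed
    \<comment> \<open>The union has \<open>10 - card (g \<inter> h)\<close> points, and 9 is the
      only size left.\<close>
    have odd_odd: "card (g \<inter> h) = 1" if gh: "g \<in> F" "h \<in> F" "g \<noteq> h" "odd (card g)" "odd (card h)" for g h
    proof -
      have "card (\<Union>{g, h}) \<notin> {6, 7, 8, 10}"
        using no_odd[of "{g, h}"] no_even[of "{g, h}" g] gh by blast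
      with proper[OF gh(1-3)] union[OF gh(1,2)] odd5[OF gh(1,4)] odd5[OF gh(2,5)]
      show ?thesis by auto
    qed
    \<comment> \<open>The odd and the even generators cover disjoint sets. If both kinds occur, the
      code is handled in two parts; if all are even, parity settles it.\<close>
    define O1 where "O1 = {g \<in> F. odd (card g)}"
    define V1 where "V1 = {g \<in> F. even (card g)}"
    have FOV: "O1 \<union> V1 = F" by (auto simp: O1_def V1_def)
    have ne: "x \<noteq> {}" if "x \<in> F" for x using FD(3)[OF that] by blast
    have "O1 \<noteq> {}"
      using light_bound_even_generators[OF C F(1,3) F(2) IH] neg by (auto simp: O1_def)
    moreover have "V1 = {}"
    proof (rule ccontr)
      assume "V1 \<noteq> {}"
      have "\<exists>c\<in>C. light_bound (card U) \<le> card c"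
      proof (rule light_bound_disjoint_parts[OF C, of O1 V1])
        show "\<Union>O1 \<union> \<Union>V1 = U" using FOV FD(2) by auto
        show "\<Union>O1 \<inter> \<Union>V1 = {}" using odd_even by (fastforce simp: O1_def V1_def)
        show "\<Union>O1 \<noteq> {}" using \<open>O1 \<noteq> {}\<close> ne by (auto simp: O1_def)
        show "\<Union>V1 \<noteq> {}" using \<open>V1 \<noteq> {}\<close> ne by (auto simp: V1_def)
      qed (use F(1,2) FOV IH in auto)
      with neg show False by contradiction
    qed
    ultimately have all_odd: "odd (card g)" if "g \<in> F" for g using FOV that by (auto simp: O1_def)
    have "\<exists>c\<in>C. light_bound (card U) \<le> card c"
    proof (rule light_bound_five_sets[OF C F(1,3) _ _ U IH])
      show "card g = 5" if "g \<in> F" for g using odd5 all_odd that by simp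
      show "card (g \<inter> h) = 1" if "g \<in> F" "h \<in> F" "g \<noteq> h" for g h
        using odd_odd[OF that] all_odd that by simp
    qed
    with neg show False by contradiction
  qed
qed

section \<open>Matrices and codes\<close>

definition supp :: "bit vec \<Rightarrow> nat set" where
  "supp u = {i. i < dim_vec u \<and> u $ i = 1}"

lemma hamming_norm_eq_card_supp: "hamming_norm u = card (supp u)"
  by (simp add: hamming_norm_def supp_def)

lemma of_nat_bit_eq_1_iff: "(of_nat k :: bit) = 1 \<longleftrightarrow> odd k"
  by (induction k) (auto simp: bit_not_one_iff)

text \<open>\<open>W x\<close> is the sum of the columns selected by the support of
  \<open>x\<close>, which brings it into the form of \<open>odd_incidence_in_code\<close>.\<close>

lemma supp_mult_mat_vec:
  assumes W: "W \<in> carrier_mat n n" and x: "x \<in> carrier_vec n"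
  shows "supp (W *\<^sub>v x) = {i. odd (card {j \<in> supp x. i \<in> supp (col W j)})}"
proof -
  have x_dim: "dim_vec x = n" using x by simp
  have entry: "(W *\<^sub>v x) $ i = of_nat (card {j \<in> supp x. i \<in> supp (col W j)})" if i: "i < n" for i
  proof -
    have "(W *\<^sub>v x) $ i = (\<Sum>j\<in>{0..<n}. W $$ (i, j) * x $ j)"
      using W x i by (auto simp: scalar_prod_def intro!: sum.cong)
    also have "\<dots> = (\<Sum>j\<in>{0..<n}. of_bool (j \<in> supp x \<and> i \<in> supp (col W j)))"
      using W i x_dim by (intro sum.cong refl) (auto simp: supp_def bit_not_one_iff)
    also have "\<dots> = of_nat (card {j \<in> {0..<n}. j \<in> supp x \<and> i \<in> supp (col W j)})"
      by (simp add: of_bool_def sum.If_cases Int_def)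
    also have "{j \<in> {0..<n}. j \<in> supp x \<and> i \<in> supp (col W j)} = {j \<in> supp x. i \<in> supp (col W j)}"
      using x_dim by (auto simp: supp_def)
    finally show ?thesis .
  qed
  have outside: "{j \<in> supp x. i \<in> supp (col W j)} = {}" if "\<not> i < n" for i
    using that W by (auto simp: supp_def)
  show ?thesis
  proof (rule Set.set_eqI)
    fix i
    show "i \<in> supp (W *\<^sub>v x) \<longleftrightarrow> i \<in> {i. odd (card {j \<in> supp x. i \<in> supp (col W j)})}"
    proof (cases "i < n")
      case True
      then show ?thesis
        using W entry[OF True] by (simp add: supp_def[of "W *\<^sub>v x"] of_nat_bit_eq_1_iff)
    next
      case False
      then have "i \<notin> supp (W *\<^sub>v x)" using W by (simp add: supp_def)
      then show ?thesis unfolding mem_Collect_eq outside[OF False] by simp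
    qed
  qed
qed

text \<open>The column space of \<open>W\<close>, each vector replaced by its support.\<close>

definition mat_code :: "bit mat \<Rightarrow> nat set set" where
  "mat_code W = {supp (W *\<^sub>v x) | x. x \<in> carrier_vec (dim_col W)}"

lemma mat_code_subset_Pow: "W \<in> carrier_mat n n \<Longrightarrow> mat_code W \<subseteq> Pow {..<n}"
  by (auto simp: mat_code_def supp_def)

lemma zero_in_mat_code:
  assumes "W \<in> carrier_mat n n"
  shows "{} \<in> mat_code W"
proof -
  have "supp (W *\<^sub>v 0\<^sub>v n) = {}" using assms by (auto simp: supp_def)
  then show ?thesis using assms unfolding mat_code_def by (intro CollectI exI[of _ "0\<^sub>v n"]) auto
qed

lemma linear_code_mat_code:
  assumes W: "W \<in> carrier_mat n n"
  shows "linear_code (mat_code W)"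
  unfolding linear_code_def
proof (intro conjI ballI)
  show "{} \<in> mat_code W" using W by (rule zero_in_mat_code)
  fix a b assume "a \<in> mat_code W" "b \<in> mat_code W"
  then obtain x y where x: "x \<in> carrier_vec n" "a = supp (W *\<^sub>v x)"
    and y: "y \<in> carrier_vec n" "b = supp (W *\<^sub>v y)"
    using W by (auto simp: mat_code_def)
  have "W *\<^sub>v (x + y) = W *\<^sub>v x + W *\<^sub>v y" using W x(1) y(1) by (rule mult_add_distrib_mat_vec)
  then have "supp (W *\<^sub>v (x + y)) = sym_diff a b"
    using W x y by (auto simp: supp_def bit_not_one_iff)
  then show "sym_diff a b \<in> mat_code W"
    using W x(1) y(1) unfolding mat_code_def by (intro CollectI exI[of _ "x + y"]) auto
qed

lemma supp_col_in_mat_code: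
  assumes W: "W \<in> carrier_mat n n" and j: "j < n"
  shows "supp (col W j) \<in> mat_code W"
proof -
  have "W *\<^sub>v unit_vec n j = col W j"
    using W j by (intro eq_vecI) (auto simp: scalar_prod_right_unit)
  then show ?thesis using W unfolding mat_code_def by (intro CollectI exI[of _ "unit_vec n j"]) auto
qed

lemma M_eq_Max_card:
  assumes W: "W \<in> carrier_mat n n"
  shows "M W (0\<^sub>v n) = Max (card ` mat_code W)"
proof -
  have "hamming_norm (W *\<^sub>v x + 0\<^sub>v n) = card (supp (W *\<^sub>v x))" for x
  proof -
    have "W *\<^sub>v x \<in> carrier_vec n" using W by (intro carrier_vecI) simp
    then show ?thesis by (simp add: hamming_norm_eq_card_supp)
  qed
  then show ?thesis
    unfolding M_def mat_code_def Setcompr_eq_image image_image by simp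
qed

lemma M_bounds:
  assumes W: "W \<in> carrier_mat n n"
  shows "c \<in> mat_code W \<Longrightarrow> card c \<le> M W (0\<^sub>v n)"
    and "\<exists>c\<in>mat_code W. M W (0\<^sub>v n) = card c"
proof -
  have fin: "finite (mat_code W)" using mat_code_subset_Pow[OF W] by (rule finite_subset) simp
  then show "c \<in> mat_code W \<Longrightarrow> card c \<le> M W (0\<^sub>v n)"
    unfolding M_eq_Max_card[OF W] by (intro Max_ge) auto
  have "Max (card ` mat_code W) \<in> card ` mat_code W"
    using fin zero_in_mat_code[OF W] by (intro Max_in) auto
  then show "\<exists>c\<in>mat_code W. M W (0\<^sub>v n) = card c" unfolding M_eq_Max_card[OF W] by auto
qed

lemma code_on_mat_code:
  assumes "W \<in> A n m"
  shows "code_on m {..<n} (mat_code W)"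
proof -
  have W: "W \<in> carrier_mat n n" "\<And>i. i < n \<Longrightarrow> W $$ (i, i) = 1" "\<And>j. j < n \<Longrightarrow> card (supp (col W j)) \<le> m"
    using assms by (auto simp: A_def hamming_norm_eq_card_supp)
  have "\<exists>c\<in>mat_code W. i \<in> c \<and> card c \<le> m" if "i < n" for i
  proof (intro bexI conjI)
    show "i \<in> supp (col W i)" using that W(1,2) by (auto simp: supp_def)
    show "card (supp (col W i)) \<le> m" by (rule W(3)[OF that])
    show "supp (col W i) \<in> mat_code W" by (rule supp_col_in_mat_code[OF W(1) that])
  qed
  then show ?thesis
    using linear_code_mat_code[OF W(1)] mat_code_subset_Pow[OF W(1)] by (simp add: code_on_def)
qed

text \<open>Every word is a sum of columns, and the finite sets of even size form a linear
  code.\<close>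

lemma even_card_mat_code:
  assumes "W \<in> A_star n m" "even m" "c \<in> mat_code W"
  shows "even (card c)"
proof -
  have W: "W \<in> carrier_mat n n" "\<And>j. j < n \<Longrightarrow> card (supp (col W j)) = m"
    using assms by (auto simp: A_star_def A_def hamming_norm_eq_card_supp)
  obtain x where x: "x \<in> carrier_vec n" "c = supp (W *\<^sub>v x)"
    using assms(3) W by (auto simp: mat_code_def)
  have "linear_code {d :: nat set. finite d \<and> even (card d)}"
    by (auto simp: linear_code_def even_card_sym_diff)
  moreover have "finite (supp x)" by (simp add: supp_def)
  moreover have "supp (col W j) \<in> {d. finite d \<and> even (card d)}" if "j \<in> supp x" for j
    using that W x(1) assms(2) by (auto simp: supp_def[of x]) (simp add: supp_def)
  ultimately have "supp (W *\<^sub>v x) \<in> {d. finite d \<and> even (card d)}"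
    unfolding supp_mult_mat_vec[OF W(1) x(1)] by (rule odd_incidence_in_code)
  then show ?thesis using x(2) by simp
qed

text \<open>Take \<open>c j\<close> as column \<open>j\<close>. The diagonal is 1 since
  \<open>j\<close> lies in \<open>c j\<close>, and products with vectors are sums of columns, hence
  words of \<open>C\<close>.\<close>

lemma matrix_of_code:
  assumes C: "linear_code C" "\<And>j. j < n \<Longrightarrow> c j \<in> C \<and> j \<in> c j \<and> c j \<subseteq> {..<n}"
  obtains W where "W \<in> carrier_mat n n" "\<And>j. j < n \<Longrightarrow> W $$ (j, j) = 1"
    "\<And>j. j < n \<Longrightarrow> supp (col W j) = c j" "mat_code W \<subseteq> C"
proof
  let ?W = "mat n n (\<lambda>(i, j). of_bool (i \<in> c j)) :: bit mat"
  show W: "?W \<in> carrier_mat n n" by simp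
  show "?W $$ (j, j) = 1" if "j < n" for j using C(2)[OF that] that by simp
  show supp: "supp (col ?W j) = c j" if "j < n" for j
    using C(2)[OF that] that by (auto simp: supp_def)
  show "mat_code ?W \<subseteq> C"
  proof
    fix d assume "d \<in> mat_code ?W"
    then obtain x where x: "x \<in> carrier_vec n" "d = supp (?W *\<^sub>v x)" by (auto simp: mat_code_def)
    have "finite (supp x)" by (simp add: supp_def)
    moreover have "supp (col ?W j) \<in> C" if "j \<in> supp x" for j
      using that x(1) C(2) supp by (simp add: supp_def[of x])
    ultimately show "d \<in> C"
      unfolding x(2) supp_mult_mat_vec[OF W x(1)] by (rule odd_incidence_in_code[OF C(1)])
  qed
qed

lemma Min_M_eqI:
  assumes "S \<subseteq> carrier_mat n n" "\<And>W. W \<in> S \<Longrightarrow> b \<le> M W (0\<^sub>v n)" "W \<in> S" "M W (0\<^sub>v n) \<le> b"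
  shows "Min {M W (0\<^sub>v n) | W. W \<in> S} = b"
proof (rule Min_eqI)
  have "M W (0\<^sub>v n) \<le> n" if "W \<in> S" for W
  proof -
    have W: "W \<in> carrier_mat n n" using assms(1) that by auto
    obtain c where "c \<in> mat_code W" "M W (0\<^sub>v n) = card c" using M_bounds(2)[OF W] by auto
    then show ?thesis using mat_code_subset_Pow[OF W] card_mono[of "{..<n}" c] by auto
  qed
  then have "{M W (0\<^sub>v n) | W. W \<in> S} \<subseteq> {..n}" by auto
  then show "finite {M W (0\<^sub>v n) | W. W \<in> S}" by (rule finite_subset) simp
  show "b \<in> {M W (0\<^sub>v n) | W. W \<in> S}" using assms(2)[OF assms(3)] assms(3,4) by (auto intro!: exI[of _ W])
qed (use assms(2) in auto)

section \<open>Extremal codes\<close>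

text \<open>\<open>K\<close> holds the weights allowed for covering words: \<open>{..4}\<close>
  serves \<open>mu\<close>, and \<open>{4}\<close> serves \<open>mu_star\<close>.\<close>

definition has_code :: "nat set \<Rightarrow> nat \<Rightarrow> nat \<Rightarrow> bool" where
  "has_code K n b \<longleftrightarrow> (\<exists>C. linear_code C \<and> C \<subseteq> Pow {..<n} \<and>
    (\<forall>i<n. \<exists>c\<in>C. i \<in> c \<and> card c \<in> K) \<and> (\<forall>c\<in>C. card c \<le> b))"

lemma has_code_empty: "has_code K 0 0"
  unfolding has_code_def by (intro exI[of _ "{{}}"]) (auto simp: linear_code_def)

text \<open>Direct sum: the second code is shifted by \<open>n\<close>, and maximal weights add
  up.\<close>

lemma has_code_add:
  assumes "has_code K n b" "has_code K m d"
  shows "has_code K (n + m) (b + d)"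
proof -
  from assms(1) obtain C where C: "linear_code C" "C \<subseteq> Pow {..<n}"
    "\<And>i. i < n \<Longrightarrow> \<exists>c\<in>C. i \<in> c \<and> card c \<in> K" "\<And>c. c \<in> C \<Longrightarrow> card c \<le> b"
    unfolding has_code_def by blast
  from assms(2) obtain D where D: "linear_code D" "D \<subseteq> Pow {..<m}"
    "\<And>i. i < m \<Longrightarrow> \<exists>c\<in>D. i \<in> c \<and> card c \<in> K" "\<And>c. c \<in> D \<Longrightarrow> card c \<le> d"
    unfolding has_code_def by blast
  define E where "E = (\<lambda>(c, d). c \<union> (+) n ` d) ` (C \<times> D)"
  have E: "c \<union> (+) n ` d \<in> E" if "c \<in> C" "d \<in> D" for c d using that by (auto simp: E_def)
  have shift: "card ((+) n ` x) = card x" for x :: "nat set" by (simp add: card_image)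
  have empty: "{} \<in> C" "{} \<in> D" using C(1) D(1) by (simp_all add: linear_codeD)
  have "sym_diff e f \<in> E" if "e \<in> E" "f \<in> E" for e f
  proof -
    from that obtain c c' x x' where *: "c \<in> C" "c' \<in> C" "x \<in> D" "x' \<in> D"
      "e = c \<union> (+) n ` x" "f = c' \<union> (+) n ` x'" by (auto simp: E_def)
    have "c \<subseteq> {..<n}" "c' \<subseteq> {..<n}" using * C(2) by auto
    then have "sym_diff e f = sym_diff c c' \<union> (+) n ` (sym_diff x x')"
      unfolding *(5,6) by auto
    with E[OF linear_codeD(2)[OF C(1) *(1,2)] linear_codeD(2)[OF D(1) *(3,4)]]
    show ?thesis by simp
  qed
  moreover have "{} \<in> E" using E[OF empty] by simp
  ultimately have "linear_code E" by (simp add: linear_code_def)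
  moreover have "E \<subseteq> Pow {..<n + m}" using C(2) D(2) by (force simp: E_def)
  moreover have "\<exists>e\<in>E. i \<in> e \<and> card e \<in> K" if i: "i < n + m" for i
  proof (cases "i < n")
    case True
    with C(3) obtain c where "c \<in> C" "i \<in> c" "card c \<in> K" by blast
    with E[OF _ empty(2), of c] show ?thesis by (intro bexI[of _ c]) auto
  next
    case False
    with i have "i - n < m" by linarith
    from D(3)[OF this] obtain x where x: "x \<in> D" "i - n \<in> x" "card x \<in> K" by blast
    moreover have "i \<in> (+) n ` x" using x(2) False by (intro rev_image_eqI) auto
    ultimately show ?thesis using E[OF empty(1) x(1)] shift
      by (intro bexI[of _ "(+) n ` x"]) auto
  qed
  moreover have "card e \<le> b + d" if "e \<in> E" for e
  proof -
    from that obtain c x where "c \<in> C" "x \<in> D" "e = c \<union> (+) n ` x" by (auto simp: E_def)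
    then show ?thesis
      using C(4)[of c] D(4)[of x] card_Un_le[of c "(+) n ` x"] shift[of x] by simp
  qed
  ultimately show ?thesis unfolding has_code_def by blast
qed

lemma has_code_mult: "has_code K n b \<Longrightarrow> has_code K (q * n) (q * b)"
  by (induction q) (simp_all add: has_code_empty has_code_add)

section \<open>Codes given by generators, verified by evaluation\<close>

fun span :: "'a set list \<Rightarrow> 'a set set" where
  "span [] = {{}}"
| "span (g # gs) = span gs \<union> sym_diff g ` span gs"

lemma linear_code_span: "linear_code (span gs)"
proof (induction gs)
  case Nil
  then show ?case by (simp add: linear_code_def)
next
  case (Cons g gs)
  note IH = linear_codeD[OF Cons.IH]
  show ?case
    unfolding linear_code_def
  proof (intro conjI ballI)
    show "{} \<in> span (g # gs)" using IH(1) by simp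
    fix a b assume a: "a \<in> span (g # gs)" and b: "b \<in> span (g # gs)"
    obtain a' where a': "a' \<in> span gs" "a = a' \<or> a = sym_diff g a'" using a by auto
    obtain b' where b': "b' \<in> span gs" "b = b' \<or> b = sym_diff g b'" using b by auto
    have "sym_diff a b = sym_diff a' b' \<or> sym_diff a b = sym_diff g (sym_diff a' b')"
      using a'(2) b'(2) by blast
    then show "sym_diff a b \<in> span (g # gs)"
      unfolding span.simps
    proof (elim disjE)
      assume eq: "sym_diff a b = sym_diff a' b'"
      show "sym_diff a b \<in> span gs \<union> sym_diff g ` span gs"
        unfolding eq by (rule UnI1[OF IH(2)[OF a'(1) b'(1)]])
    next
      assume eq: "sym_diff a b = sym_diff g (sym_diff a' b')"
      show "sym_diff a b \<in> span gs \<union> sym_diff g ` span gs"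
        unfolding eq by (rule UnI2[OF imageI[OF IH(2)[OF a'(1) b'(1)]]])
    qed
  qed
qed

lemma gens_in_span: "g \<in> set gs \<Longrightarrow> g \<in> span gs"
proof (induction gs)
  case (Cons h gs)
  have "{} \<in> span gs" using linear_code_span by (rule linear_codeD)
  then have "h \<in> sym_diff h ` span gs" by (intro rev_image_eqI) auto
  with Cons show ?case by auto
qed simp

text \<open>Words are bit lists, so that the finitely many small codes can be checked by computation.\<close>

definition ones :: "bool list \<Rightarrow> nat set" where
  "ones u = {i. i < length u \<and> u ! i}"

definition weight :: "bool list \<Rightarrow> nat" where
  "weight u = length (filter (\<lambda>b. b) u)"

text \<open>Lists the sums of all sublists of generators; repetitions are harmless because every
  entry is checked.\<close>

fun words :: "nat \<Rightarrow> bool list list \<Rightarrow> bool list list" where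
  "words n [] = [replicate n False]"
| "words n (g # gs) = words n gs @ map (map2 (\<noteq>) g) (words n gs)"

lemma card_ones: "card (ones u) = weight u"
  by (simp add: ones_def weight_def length_filter_conv_card)

lemma length_words: "\<lbrakk>\<forall>g\<in>set gs. length g = n; u \<in> set (words n gs)\<rbrakk> \<Longrightarrow> length u = n"
  by (induction gs arbitrary: u) auto

lemma ones_words:
  assumes "\<forall>g\<in>set gs. length g = n"
  shows "ones ` set (words n gs) = span (map ones gs)"
  using assms
proof (induction gs)
  case Nil
  then show ?case by (auto simp: ones_def)
next
  case (Cons g gs)
  have "ones (map2 (\<noteq>) g u) = sym_diff (ones g) (ones u)" if "u \<in> set (words n gs)" for u
    using Cons.prems length_words[OF _ that] by (auto simp: ones_def)
  then have "ones ` map2 (\<noteq>) g ` set (words n gs) = sym_diff (ones g) ` ones ` set (words n gs)"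
    unfolding image_image by (intro image_cong refl)
  with Cons show ?case by (simp add: image_Un)
qed

definition good_generators :: "nat set \<Rightarrow> nat \<Rightarrow> nat \<Rightarrow> bool list list \<Rightarrow> bool" where
  "good_generators K n b gs \<longleftrightarrow> (\<forall>g\<in>set gs. length g = n \<and> weight g \<in> K) \<and>
    list_all (\<lambda>i. list_ex (\<lambda>g. g ! i) gs) [0..<n] \<and> list_all (\<lambda>u. weight u \<le> b) (words n gs)"

lemma has_code_good_generators:
  assumes "good_generators K n b gs"
  shows "has_code K n b"
proof -
  have len: "\<forall>g\<in>set gs. length g = n" and K: "\<And>g. g \<in> set gs \<Longrightarrow> weight g \<in> K"
    and cov: "\<And>i. i < n \<Longrightarrow> \<exists>g\<in>set gs. g ! i"
    and b: "\<And>u. u \<in> set (words n gs) \<Longrightarrow> weight u \<le> b"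
    using assms by (auto simp: good_generators_def list_all_iff list_ex_iff)
  have span: "\<exists>u\<in>set (words n gs). c = ones u" if "c \<in> span (map ones gs)" for c
    using that ones_words[OF len] by auto
  have "span (map ones gs) \<subseteq> Pow {..<n}"
    using span length_words[OF len] by (fastforce simp: ones_def)
  moreover have "\<exists>c\<in>span (map ones gs). i \<in> c \<and> card c \<in> K" if "i < n" for i
  proof -
    from cov[OF that] obtain g where g: "g \<in> set gs" "g ! i" by auto
    then have "ones g \<in> span (map ones gs)" by (intro gens_in_span) auto
    with g K len that show ?thesis
      by (intro bexI[of _ "ones g"]) (auto simp: card_ones, simp add: ones_def)
  qed
  moreover have "card c \<le> b" if "c \<in> span (map ones gs)" for c
    using span[OF that] b by (auto simp: card_ones)
  ultimately show ?thesis unfolding has_code_def using linear_code_span by blast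
qed

definition bits :: "nat list \<Rightarrow> bool list" where
  "bits = map (\<lambda>k. k = 1)"

text \<open>A single point, the even-weight code of length 3, and the simplex code of length 7: its
  coordinates are the nonzero binary triples, so every nonzero word has weight 4.\<close>

lemma small_codes_at_most_4:
  "has_code {..4} 1 1" "has_code {..4} 3 2" "has_code {..4} 7 4"
proof -
  show "has_code {..4} 1 1"
    by (rule has_code_good_generators[of _ _ _ "map bits [[1]]"])
      (simp add: good_generators_def bits_def weight_def upt_conv_Cons numeral_eq_Suc)
  show "has_code {..4} 3 2"
    by (rule has_code_good_generators[of _ _ _ "map bits [[1,1,0],[0,1,1]]"])
      (simp add: good_generators_def bits_def weight_def upt_conv_Cons numeral_eq_Suc)
  show "has_code {..4} 7 4"
    by (rule has_code_good_generators[of _ _ _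
          "map bits [[1,0,1,0,1,0,1],[0,1,1,0,0,1,1],[0,0,0,1,1,1,1]]"])
      (simp add: good_generators_def bits_def weight_def upt_conv_Cons numeral_eq_Suc)
qed

lemma small_codes_4:
  "has_code {4} 4 4" "has_code {4} 5 4" "has_code {4} 6 4" "has_code {4} 7 4"
proof -
  show "has_code {4} 4 4"
    by (rule has_code_good_generators[of _ _ _ "map bits [[1,1,1,1]]"])
      (simp add: good_generators_def bits_def weight_def upt_conv_Cons numeral_eq_Suc)
  show "has_code {4} 5 4"
    by (rule has_code_good_generators[of _ _ _ "map bits [[1,1,1,1,0],[0,1,1,1,1]]"])
      (simp add: good_generators_def bits_def weight_def upt_conv_Cons numeral_eq_Suc)
  show "has_code {4} 6 4"
    by (rule has_code_good_generators[of _ _ _ "map bits [[1,1,1,1,0,0],[0,0,1,1,1,1]]"])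
      (simp add: good_generators_def bits_def weight_def upt_conv_Cons numeral_eq_Suc)
  show "has_code {4} 7 4"
    by (rule has_code_good_generators[of _ _ _
          "map bits [[1,0,1,0,1,0,1],[0,1,1,0,0,1,1],[0,0,0,1,1,1,1]]"])
      (simp add: good_generators_def bits_def weight_def upt_conv_Cons numeral_eq_Suc)
qed

text \<open>
  The last code is the cut space of the complete graph on five vertices: its words are the cuts,
  of size 4 or 6. In the other two, the Fano words are extended by a set of three
  noncollinear points of the Fano plane together with one further bulb.
\<close>
lemma small_codes_4_bound_6:
  "has_code {4} 8 6" "has_code {4} 9 6" "has_code {4} 10 6"
proof -
  show "has_code {4} 8 6"
    by (rule has_code_good_generators[of _ _ _
          "map bits [[1,0,1,0,1,0,1,0],[0,1,1,0,0,1,1,0],[0,0,0,1,1,1,1,0],[1,1,0,1,0,0,0,1]]"])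
      (simp add: good_generators_def bits_def weight_def upt_conv_Cons numeral_eq_Suc)
  show "has_code {4} 9 6"
    by (rule has_code_good_generators[of _ _ _
          "map bits [[1,0,1,0,1,0,1,0,0],[0,1,1,0,0,1,1,0,0],[0,0,0,1,1,1,1,0,0],
            [1,1,0,1,0,0,0,1,0],[1,1,0,1,0,0,0,0,1]]"])
      (simp add: good_generators_def bits_def weight_def upt_conv_Cons numeral_eq_Suc)
  show "has_code {4} 10 6"
    by (rule has_code_good_generators[of _ _ _
          "map bits [[1,1,1,1,0,0,0,0,0,0],[1,0,0,0,1,1,1,0,0,0],[0,1,0,0,1,0,0,1,1,0],[0,0,1,0,0,1,0,1,0,1]]"])
      (simp add: good_generators_def bits_def weight_def upt_conv_Cons numeral_eq_Suc)
qed

text \<open>Blocks of length 7 and weight 4, with the remaining \<open>r\<close> points split into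
  blocks of length 3 (weight 2) and 1 (weight 1).\<close>

lemma has_code_light_bound: "has_code {..4} n (light_bound n)"
proof -
  obtain q r where n: "n = 7 * q + r" "r \<in> {0, 1, 2, 3, 4, 5, 6}" by (rule light_bound_cases)
  note one = small_codes_at_most_4(1) and three = small_codes_at_most_4(2)
  have two: "has_code {..4} 2 2" using has_code_add[OF one one] by (simp add: numeral_2_eq_2)
  have "has_code {..4} r (light_bound r)"
    using n(2) has_code_empty one two three has_code_add[OF three one] has_code_add[OF three two]
      has_code_add[OF three three]
    by (auto simp: light_bound_values simp del: One_nat_def)
  with has_code_add[OF has_code_mult[OF small_codes_at_most_4(3), of q]]
  show ?thesis unfolding n(1) light_bound_residue by (simp add: mult.commute)
qed

lemma star_bound_residue: "(2 * (7 * q + r) + 6) div 7 = 2 * q + (2 * r + 6) div (7 :: nat)"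
proof -
  have eq: "2 * (7 * q + r) + 6 = (2 * r + 6) + 2 * q * 7" by simp
  show ?thesis unfolding eq by (rule div_mult_self1) simp
qed

text \<open>Residues 4, 5 and 6 add one short block of weight 4 to the blocks of length 7. Residues
  1, 2 and 3 are too short for a word of weight 4, so one block of length 7 is merged with them into
  length 8, 9 or 10.\<close>

lemma has_code_star_bound:
  assumes "n \<ge> 4"
  shows "has_code {4} n (2 * ((2 * n + 6) div 7))"
proof -
  obtain q r where n: "n = 7 * q + r" "r \<in> {0, 1, 2, 3, 4, 5, 6}" by (rule light_bound_cases)
  have b: "2 * ((2 * n + 6) div 7) = 4 * q + 2 * ((2 * r + 6) div 7)"
    unfolding n(1) star_bound_residue by simp
  have fano: "has_code {4} (7 * p) (4 * p)" for p
    using has_code_mult[OF small_codes_4(4), of p] by (simp add: mult.commute)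
  show ?thesis
  proof (cases "r \<in> {1, 2, 3}")
    case True
    \<comment> \<open>For \<open>r \<le> 3\<close> the assumption \<open>n \<ge> 4\<close>
      guarantees a block to merge.\<close>
    with assms n(1) obtain p where p: "q = Suc p" by (cases q) auto
    have "has_code {4} (7 + r) 6" using True small_codes_4_bound_6 by auto
    from has_code_add[OF fano[of p] this] have "has_code {4} (7 * p + (7 + r)) (4 * p + 6)" .
    moreover have "7 * p + (7 + r) = n" using n(1) p by simp
    moreover have "4 * p + 6 = 2 * ((2 * n + 6) div 7)" unfolding b p using True by auto
    ultimately show ?thesis by simp
  next
    case False
    with n(2) consider "r = 0" | "r \<in> {4, 5, 6}" by auto
    then show ?thesis
    proof cases
      case 1
      with b have "2 * ((2 * n + 6) div 7) = 4 * q" by simp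
      moreover have "n = 7 * q" using 1 n(1) by simp
      ultimately show ?thesis using fano[of q] by metis
    next
      case 2
      then have "has_code {4} r 4" using small_codes_4 by auto
      from has_code_add[OF fano[of q] this] have "has_code {4} n (4 * q + 4)" using n(1) by simp
      moreover have "4 * q + 4 = 2 * ((2 * n + 6) div 7)" unfolding b using 2 by auto
      ultimately show ?thesis by simp
    qed
  qed
qed

section \<open>Ceilings and the values of \<open>mu\<close> and \<open>mu_star\<close>\<close>

lemma light_bound_real:
  "\<lceil>4 * real n / 7\<rceil> + (if n mod 7 = 5 then 1 else 0) = int (light_bound n)"
proof -
  define k where "k = (4 * n + 6) div 7"
  have "7 * k \<le> 4 * n + 6" "4 * n \<le> 7 * k" unfolding k_def by linarith+
  then have "7 * real k \<le> 4 * real n + 6" "4 * real n \<le> 7 * real k" by linarith+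
  then have "\<lceil>4 * real n / 7\<rceil> = int k" unfolding ceiling_eq_iff by (simp add: field_simps)
  then show ?thesis by (simp add: light_bound_def k_def)
qed

lemma star_bound_real: "\<lceil>2 * real n / 7\<rceil> = int ((2 * n + 6) div 7)"
proof -
  define k where "k = (2 * n + 6) div 7"
  have "7 * k \<le> 2 * n + 6" "2 * n \<le> 7 * k" unfolding k_def by linarith+
  then have "7 * real k \<le> 2 * real n + 6" "2 * real n \<le> 7 * real k" by linarith+
  then show ?thesis unfolding ceiling_eq_iff k_def[symmetric] by (simp add: field_simps)
qed

text \<open>Used twice: for the lower bound on \<open>mu_star\<close>, where all weights are even,
  and for the minimality among even integers in the final statement.\<close>

lemma light_bound_even_ceiling:
  assumes "even e" "light_bound n \<le> e"
  shows "2 * ((2 * n + 6) div 7) \<le> e"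
proof -
  obtain q r where n: "n = 7 * q + r" "r \<in> {0, 1, 2, 3, 4, 5, 6}" by (rule light_bound_cases)
  have "(2 * n + 6) div 7 = 2 * q + (2 * r + 6) div 7" unfolding n(1) by (rule star_bound_residue)
  moreover obtain f where f: "e = 2 * f" using assms(1) by (rule evenE)
  have "4 * q + light_bound r \<le> 2 * f" using assms(2) unfolding n(1) light_bound_residue f .
  with n(2) have "2 * q + (2 * r + 6) div 7 \<le> f"
    by (elim insertE emptyE) (simp_all add: light_bound_values del: One_nat_def)
  ultimately show ?thesis by (simp add: f)
qed

lemma light_bound_le_star_bound: "light_bound n \<le> 2 * ((2 * n + 6) div 7)"
proof -
  obtain q r where n: "n = 7 * q + r" "r \<in> {0, 1, 2, 3, 4, 5, 6}" by (rule light_bound_cases)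
  have "(2 * n + 6) div 7 = 2 * q + (2 * r + 6) div 7" unfolding n(1) by (rule star_bound_residue)
  moreover have "light_bound n = 4 * q + light_bound r" unfolding n(1) by (rule light_bound_residue)
  ultimately show ?thesis using n(2) by (auto simp: light_bound_values simp del: One_nat_def)
qed

lemma has_code_matrix:
  assumes "has_code K n b"
  obtains W where "W \<in> carrier_mat n n" "\<And>j. j < n \<Longrightarrow> W $$ (j, j) = 1"
    "\<And>j. j < n \<Longrightarrow> hamming_norm (col W j) \<in> K" "M W (0\<^sub>v n) \<le> b"
proof -
  from assms obtain C where C: "linear_code C" "C \<subseteq> Pow {..<n}"
    "\<forall>i<n. \<exists>c\<in>C. i \<in> c \<and> card c \<in> K" "\<forall>c\<in>C. card c \<le> b"
    unfolding has_code_def by blast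
  then obtain c where c: "\<And>i. i < n \<Longrightarrow> c i \<in> C \<and> i \<in> c i \<and> card (c i) \<in> K" by metis
  then have "c j \<in> C \<and> j \<in> c j \<and> c j \<subseteq> {..<n}" if "j < n" for j using that C(2) by auto
  from matrix_of_code[OF C(1) this] obtain W where W: "W \<in> carrier_mat n n"
    "\<And>j. j < n \<Longrightarrow> W $$ (j, j) = 1" "\<And>j. j < n \<Longrightarrow> supp (col W j) = c j" "mat_code W \<subseteq> C" by blast
  have "M W (0\<^sub>v n) \<le> b" using M_bounds(2)[OF W(1)] W(4) C(4) by auto
  with that[OF W(1,2)] c W(3) show ?thesis by (simp add: hamming_norm_eq_card_supp)
qed

lemma light_bound_le_M:
  assumes "W \<in> A n m" "m \<le> 5"
  shows "light_bound n \<le> M W (0\<^sub>v n)"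
proof -
  have "W \<in> A n 5" using assms by (auto simp: A_def)
  from light_bound_le_max_weight[OF code_on_mat_code[OF this]]
  obtain c where "c \<in> mat_code W" "light_bound n \<le> card c" by auto
  moreover have "W \<in> carrier_mat n n" using assms(1) by (simp add: A_def)
  ultimately show ?thesis using M_bounds(1) le_trans by blast
qed

text \<open>The lower bound admits columns of weight up to 5 and the construction uses weight at
  most 4, so both values of \<open>m\<close> give the same result.\<close>

lemma mu_eq_light_bound:
  assumes "m \<in> {4, 5}"
  shows "mu n m = light_bound n"
proof -
  obtain W where W: "W \<in> carrier_mat n n" "\<And>j. j < n \<Longrightarrow> W $$ (j, j) = 1"
    "\<And>j. j < n \<Longrightarrow> hamming_norm (col W j) \<in> {..4}" "M W (0\<^sub>v n) \<le> light_bound n"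
    using has_code_matrix[OF has_code_light_bound] by blast
  have "W \<in> A n m" using W(1-3) assms by (force simp: A_def)
  then show ?thesis
    unfolding mu_def
    by (rule Min_M_eqI[rotated 2]) (use assms W(4) light_bound_le_M in \<open>auto simp: A_def\<close>)
qed

lemma mu_star_eq:
  assumes "n \<ge> 4"
  shows "mu_star n 4 = 2 * ((2 * n + 6) div 7)"
proof -
  obtain W where W: "W \<in> carrier_mat n n" "\<And>j. j < n \<Longrightarrow> W $$ (j, j) = 1"
    "\<And>j. j < n \<Longrightarrow> hamming_norm (col W j) \<in> {4}" "M W (0\<^sub>v n) \<le> 2 * ((2 * n + 6) div 7)"
    using has_code_matrix[OF has_code_star_bound[OF assms]] by blast
  have WA: "W \<in> A_star n 4" using W(1-3) by (auto simp: A_star_def A_def)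
  have "2 * ((2 * n + 6) div 7) \<le> M V (0\<^sub>v n)" if V: "V \<in> A_star n 4" for V
  proof (rule light_bound_even_ceiling)
    have VA: "V \<in> A n 4" using V by (simp add: A_star_def)
    then show "light_bound n \<le> M V (0\<^sub>v n)" by (rule light_bound_le_M) simp
    have "V \<in> carrier_mat n n" using VA by (simp add: A_def)
    from M_bounds(2)[OF this] even_card_mat_code[OF V] show "even (M V (0\<^sub>v n))" by auto
  qed
  moreover have "A_star n 4 \<subseteq> carrier_mat n n" by (auto simp: A_star_def A_def)
  ultimately show ?thesis
    unfolding mu_star_def using WA W(4) by (intro Min_M_eqI)
qed

text \<open>The equations are over the integers, so that \<open>7 * k - 2\<close> is true
  subtraction and ceilings need no conversion.\<close>

theorem theorem1p1:
  fixes n :: nat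
  assumes "n \<ge> 1"
  shows "(\<forall>j\<in>{4, 5}.
            ((\<forall>k::nat. k \<ge> 1 \<longrightarrow> int n \<noteq> 7 * int k - 2) \<longrightarrow>
               int (mu n j) = \<lceil>4 * real n / 7\<rceil>) \<and>
            (\<forall>k::nat. k \<ge> 1 \<and> int n = 7 * int k - 2 \<longrightarrow>
               int (mu n j) = \<lceil>4 * real n / 7\<rceil> + 1 \<and>
               \<lceil>4 * real n / 7\<rceil> + 1 = 4 * int k)) \<and>
         (n \<ge> 4 \<longrightarrow>
            int (mu_star n 4) = 2 * \<lceil>2 * real n / 7\<rceil> \<and>
            even (int (mu_star n 4)) \<and> int (mu n 4) \<le> int (mu_star n 4) \<and>
            (\<forall>e::int. even e \<and> int (mu n 4) \<le> e \<longrightarrow> int (mu_star n 4) \<le> e))"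
proof (intro conjI ballI impI allI)
  fix j :: nat
  assume j: "j \<in> {4, 5}"
  {
    assume no: "\<forall>k::nat. k \<ge> 1 \<longrightarrow> int n \<noteq> 7 * int k - 2"
    have "n mod 7 \<noteq> 5"
    proof
      assume "n mod 7 = 5"
      then obtain p where "n = 7 * p + 5" by (metis mult_div_mod_eq)
      then have "int n = 7 * int (p + 1) - 2" by simp
      with no show False by (metis le_add2)
    qed
    then show "int (mu n j) = \<lceil>4 * real n / 7\<rceil>"
      using light_bound_real[of n] mu_eq_light_bound[OF j] by simp
  next
    fix k :: nat
    assume k: "k \<ge> 1 \<and> int n = 7 * int k - 2"
    then obtain p where "k = Suc p" by (cases k) auto
    with k have n: "n = 7 * p + 5" "k = p + 1" by auto
    then have bound: "\<lceil>4 * real n / 7\<rceil> + 1 = int (light_bound n)" using light_bound_real[of n] by simp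
    then show "int (mu n j) = \<lceil>4 * real n / 7\<rceil> + 1" using mu_eq_light_bound[OF j] by simp
    show "\<lceil>4 * real n / 7\<rceil> + 1 = 4 * int k"
      unfolding bound unfolding n light_bound_residue by (simp add: light_bound_values)
  }
next
  assume n: "n \<ge> 4"
  have mu: "mu n 4 = light_bound n" by (rule mu_eq_light_bound) simp
  note star = mu_star_eq[OF n]
  show "int (mu_star n 4) = 2 * \<lceil>2 * real n / 7\<rceil>" unfolding star star_bound_real by simp
  show "even (int (mu_star n 4))" unfolding star by simp
  show "int (mu n 4) \<le> int (mu_star n 4)"
    unfolding star mu using light_bound_le_star_bound by (simp only: of_nat_le_iff)
  fix e :: int
  assume e: "even e \<and> int (mu n 4) \<le> e"
  \<comment> \<open>\<open>e\<close> is at least a natural number, so it is nonnegative and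
    \<open>nat e\<close> keeps its value.\<close>
  then have "even (nat e)" "light_bound n \<le> nat e" unfolding mu by (auto simp: even_nat_iff)
  then have "mu_star n 4 \<le> nat e" unfolding star by (rule light_bound_even_ceiling)
  then show "int (mu_star n 4) \<le> e" using e by linarith
qed

end
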